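(* Let $G$ be a connected graph and $\mathcal{P}$ a set of robust regular bounded profiles in $G$. Then there is a nested set $N$ of separations of $G$ which efficiently distinguishes all distinguishable profiles in $\mathcal{P}$, i.e. for any two distinguishable $P,P'\in\mathcal{P}$ some element of $N$ efficiently distinguishes $P$ and $P'$.
   Context: A separation of a graph $G=(V,E)$ is a pair $(A,B)$ with $A\cup B=V$ and no edge between $A\smallsetminus B$ and $B\smallsetminus A$; its separator is $A\cap B$ and its order is $|A\cap B|$ (when finite). Its inverse is $(B,A)$; the unoriented separation is $\{A,B\}$. $(A,B)\le(C,D)$ iff $A\subseteq C$ and $B\supseteq D$; join $(A,B)\lor(C,D)=(A\cup C,B\cap D)$. Two separations are nested if suitable orientations of them are comparable under $\le$; a set is nested if its elements are pairwise nested. For $k\in\mathbb{N}\cup\{\aleph_0\}$, a $k$-profile is a set $P$ of separations of order $<k$ containing exactly one of $(A,B),(B,A)$ for each separation of order $<k$, which is consistent (no $(A,B),(C,D)\in P$ with $\{A,B\}\neq\{C,D\}$ and $(B,A)\le(C,D)$) and satisfies $(B\cap D,A\cup C)\notin P$ for all $(A,B),(C,D)\in P$. $P$ is robust if for all $(A,B)\in P$ and every separation $(C,D)$ of finite order: if $|(A,B)\lor(C,D)|<|A\cap B|$ and $|(A,B)\lor(D,C)|<|A\cap B|$ then one of these two joins lies in $P$. $P$ is regular if it contains no separation $(V,X)$. $P$ is bounded if it is a $k$-profile for some $k\in\mathbb{N}$ but is not a subset of any $\aleph_0$-profile. A separation $\{A,B\}$ distinguishes $P,P'$ if $(A,B)\in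 P$, $(B,A)\in P'$ or vice versa, efficiently if its order is minimal among all distinguishing separations; $P,P'$ are distinguishable if some separation distinguishes them. *)

theory Defs
  imports Main "HOL-Library.Extended_Nat"
begin

text \<open>Graphs are simple and undirected, possibly infinite: a vertex set \<open>V\<close> and a set \<open>E\<close> of
  two-element subsets of \<open>V\<close>.\<close>

definition simple_graph :: "'a set \<Rightarrow> 'a set set \<Rightarrow> bool" where
  "simple_graph V E \<longleftrightarrow> (\<forall>e\<in>E. \<exists>u\<in>V. \<exists>v\<in>V. u \<noteq> v \<and> e = {u, v})"

definition connected_graph :: "'a set \<Rightarrow> 'a set set \<Rightarrow> bool" where
  "connected_graph V E \<longleftrightarrow>
     simple_graph V E \<and> (\<forall>u\<in>V. \<forall>v\<in>V. (u, v) \<in> {(x, y). {x, y} \<in> E}\<^sup>*)"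

type_synonym 'a osep = "'a set \<times> 'a set"

fun separation :: "'a set \<Rightarrow> 'a set set \<Rightarrow> 'a osep \<Rightarrow> bool" where
  "separation V E (A, B) \<longleftrightarrow> A \<union> B = V \<and> (\<forall>x\<in>A - B. \<forall>y\<in>B - A. {x, y} \<notin> E)"

text \<open>The value \<open>\<infinity>\<close> stands for any infinite order.\<close>

fun sep_order :: "'a osep \<Rightarrow> enat" where
  "sep_order (A, B) = (if finite (A \<inter> B) then enat (card (A \<inter> B)) else \<infinity>)"

fun sep_le :: "'a osep \<Rightarrow> 'a osep \<Rightarrow> bool" where
  "sep_le (A, B) (C, D) \<longleftrightarrow> A \<subseteq> C \<and> D \<subseteq> B"

fun sep_join :: "'a osep \<Rightarrow> 'a osep \<Rightarrow> 'a osep" where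
  "sep_join (A, B) (C, D) = (A \<union> C, B \<inter> D)"

text \<open>An unoriented separation is the set \<open>{A, B}\<close>; its orientations are \<open>(A, B)\<close> and \<open>(B, A)\<close>.\<close>

type_synonym 'a usep = "'a set set"

definition unoriented_separations :: "'a set \<Rightarrow> 'a set set \<Rightarrow> 'a usep set" where
  "unoriented_separations V E = {{A, B} | A B. separation V E (A, B)}"

definition nested :: "'a usep \<Rightarrow> 'a usep \<Rightarrow> bool" where
  "nested r s \<longleftrightarrow> (\<exists>A B C D. r = {A, B} \<and> s = {C, D} \<and> sep_le (A, B) (C, D))"

definition nested_set :: "'a usep set \<Rightarrow> bool" where
  "nested_set N \<longleftrightarrow> (\<forall>r\<in>N. \<forall>s\<in>N. nested r s)"

text \<open>The index \<open>k = \<infinity>\<close> plays the role of \<open>\<aleph>\<^sub>0\<close>. Unique existence over the set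
  \<open>{(A, B), (B, A)}\<close> also makes sense for the degenerate separation \<open>(V, V)\<close>, whose two orientations
  coincide.\<close>

definition profile :: "'a set \<Rightarrow> 'a set set \<Rightarrow> enat \<Rightarrow> 'a osep set \<Rightarrow> bool" where
  "profile V E k P \<longleftrightarrow>
     (\<forall>s\<in>P. separation V E s \<and> sep_order s < k) \<and>
     (\<forall>A B. separation V E (A, B) \<and> sep_order (A, B) < k \<longrightarrow>
        (\<exists>!s. s \<in> {(A, B), (B, A)} \<and> s \<in> P)) \<and>
     (\<forall>A B C D. (A, B) \<in> P \<and> (C, D) \<in> P \<and> {A, B} \<noteq> {C, D} \<longrightarrow> \<not> sep_le (B, A) (C, D)) \<and>
     (\<forall>A B C D. (A, B) \<in> P \<and> (C, D) \<in> P \<longrightarrow> (B \<inter> D, A \<union> C) \<notin> P)"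

definition robust :: "'a set \<Rightarrow> 'a set set \<Rightarrow> 'a osep set \<Rightarrow> bool" where
  "robust V E P \<longleftrightarrow>
     (\<forall>A B C D. (A, B) \<in> P \<and> separation V E (C, D) \<and> sep_order (C, D) < \<infinity> \<and>
        sep_order (sep_join (A, B) (C, D)) < sep_order (A, B) \<and>
        sep_order (sep_join (A, B) (D, C)) < sep_order (A, B) \<longrightarrow>
        sep_join (A, B) (C, D) \<in> P \<or> sep_join (A, B) (D, C) \<in> P)"

definition regular :: "'a set \<Rightarrow> 'a osep set \<Rightarrow> bool" where
  "regular V P \<longleftrightarrow> (\<forall>X. (V, X) \<notin> P)"

definition bounded_profile :: "'a set \<Rightarrow> 'a set set \<Rightarrow> 'a osep set \<Rightarrow> bool" where
  "bounded_profile V E P \<longleftrightarrow>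
     (\<exists>k::nat. profile V E (enat k) P) \<and> \<not> (\<exists>Q. profile V E \<infinity> Q \<and> P \<subseteq> Q)"

definition distinguishes ::
    "'a set \<Rightarrow> 'a set set \<Rightarrow> 'a osep \<Rightarrow> 'a osep set \<Rightarrow> 'a osep set \<Rightarrow> bool" where
  "distinguishes V E s P P' \<longleftrightarrow>
     separation V E s \<and>
     (s \<in> P \<and> prod.swap s \<in> P' \<or> prod.swap s \<in> P \<and> s \<in> P')"

definition distinguishable ::
    "'a set \<Rightarrow> 'a set set \<Rightarrow> 'a osep set \<Rightarrow> 'a osep set \<Rightarrow> bool" where
  "distinguishable V E P P' \<longleftrightarrow> (\<exists>s. distinguishes V E s P P')"

text \<open>Both \<open>distinguishes\<close> and \<open>sep_order\<close> are invariant under inversion, so the choice of the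
  orientation \<open>(A, B)\<close> of the unoriented separation is immaterial.\<close>

definition efficiently_distinguishes ::
    "'a set \<Rightarrow> 'a set set \<Rightarrow> 'a usep \<Rightarrow> 'a osep set \<Rightarrow> 'a osep set \<Rightarrow> bool" where
  "efficiently_distinguishes V E r P P' \<longleftrightarrow>
     (\<exists>A B. r = {A, B} \<and> distinguishes V E (A, B) P P' \<and>
        (\<forall>s. distinguishes V E s P P' \<longrightarrow> sep_order (A, B) \<le> sep_order s))"

end

theory Submission
  imports Defs
begin

text \<open>
  A regular bounded profile selects a component of \<open>G - X\<close> for every separator \<open>X\<close> that it orients.
  The separator \<open>X\<close> of an efficient distinguisher is \<^emph>\<open>tight\<close>: the components selected
  by the two profiles both have all of \<open>X\<close> as neighbourhood. A tight separator crosses only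
  finitely many others of bounded size. When two efficient separators cross, submodularity
  (together with robustness if their sizes differ) yields a corner that is again efficient and
  crosses fewer separators. Choosing, size by size, separators with minimal crossing numbers
  therefore produces a non-crossing system of separators. Each of these separators \<open>X\<close> is
  turned into the separations \<open>{V - C, C \<union> X}\<close> for all but one of the components \<open>C\<close> with
  neighbourhood \<open>X\<close>; the omitted components are chosen coherently by a well-ordering of the
  vertices.
\<close>

section \<open>Preliminaries\<close>

lemma card_add_less_if_Un_psubset:
  assumes "finite A" "finite B" "finite C" "finite D" "A \<union> B \<subset> C \<union> D" "A \<inter> B \<subseteq> C \<inter> D"
  shows "card A + card B < card C + card D"
proof -
  have "card (A \<union> B) < card (C \<union> D)" "card (A \<inter> B) \<le> card (C \<inter> D)"
    using assms by (auto intro: psubset_card_mono card_mono)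
  then show ?thesis
    using card_Un_Int[of A B] card_Un_Int[of C D] assms(1-4) by linarith
qed

lemma coherent_choice:
  fixes \<F> :: "'i \<Rightarrow> 'b set set"
  assumes nonempty: "\<And>i. i \<in> I \<Longrightarrow> \<Union>(\<F> i) \<noteq> {}" and disjnt: "\<And>i. i \<in> I \<Longrightarrow> pairwise disjnt (\<F> i)"
  obtains f where "\<And>i. i \<in> I \<Longrightarrow> f i \<in> \<F> i"
    and "\<And>i j C D. i \<in> I \<Longrightarrow> j \<in> I \<Longrightarrow> C \<in> \<F> i \<Longrightarrow> D \<in> \<F> j \<Longrightarrow> f j \<subseteq> C \<Longrightarrow> f i \<subseteq> D \<Longrightarrow> C = f i"
proof -
  obtain r :: "'b rel" where r: "Well_order r" "Field r = UNIV"
    using well_ordering by metis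
  then have wo: "wo_rel r" by (simp add: wo_rel_def)
  define m where "m i = wo_rel.minim r (\<Union>(\<F> i))" for i
  have m_mem: "m i \<in> \<Union>(\<F> i)" if "i \<in> I" for i
    unfolding m_def using wo_rel.minim_in[OF wo _ nonempty[OF that]] r(2) by simp
  have m_least: "(m i, x) \<in> r" if "x \<in> \<Union>(\<F> i)" for i x
    unfolding m_def using wo_rel.minim_least[OF wo _ that] r(2) by simp
  have "\<forall>i. \<exists>C. i \<in> I \<longrightarrow> m i \<in> C \<and> C \<in> \<F> i" using m_mem by blast
  then obtain f where f: "\<And>i. i \<in> I \<Longrightarrow> m i \<in> f i" "\<And>i. i \<in> I \<Longrightarrow> f i \<in> \<F> i" by metis
  have "C = f i" if "i \<in> I" "j \<in> I" "C \<in> \<F> i" "D \<in> \<F> j" "f j \<subseteq> C" "f i \<subseteq> D" for i j C D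
  proof -
    have mem: "m j \<in> C" "m i \<in> D" using f(1) that by blast+
    then have "(m i, m j) \<in> r" "(m j, m i) \<in> r" using m_least that(3,4) by blast+
    then have "m i = m j" using wo_rel.ANTISYM[OF wo] by (auto dest: antisymD)
    then have "m i \<in> C \<inter> f i" using mem(1) f(1)[OF that(1)] by simp
    then show ?thesis
      using disjnt[OF that(1)] f(2)[OF that(1)] that(3) unfolding pairwise_def disjnt_def by blast
  qed
  then show thesis using that f(2) by blast
qed

lemma separation_swap: "separation V E (A, B) \<Longrightarrow> separation V E (B, A)"
  using insert_commute[of _ _ "{}"] by (metis Un_commute separation.simps)

lemma separation_join:
  "separation V E (A, B) \<Longrightarrow> separation V E (C, D) \<Longrightarrow> separation V E (A \<union> C, B \<inter> D)"
  by auto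

lemma card_opposite_corners:
  assumes "separation V E (A, B)" "separation V E (C, D)" "finite (A \<inter> B)" "finite (C \<inter> D)"
  shows "card ((A \<union> C) \<inter> (B \<inter> D)) + card ((B \<union> D) \<inter> (A \<inter> C)) = card (A \<inter> B) + card (C \<inter> D)"
proof -
  have "A \<union> B = C \<union> D" using assms(1,2) by simp
  then have union: "((A \<union> C) \<inter> (B \<inter> D)) \<union> ((B \<union> D) \<inter> (A \<inter> C)) = (A \<inter> B) \<union> (C \<inter> D)" by blast
  have inter: "((A \<union> C) \<inter> (B \<inter> D)) \<inter> ((B \<union> D) \<inter> (A \<inter> C)) = (A \<inter> B) \<inter> (C \<inter> D)" by blast
  have "finite ((A \<union> C) \<inter> (B \<inter> D))" "finite ((B \<union> D) \<inter> (A \<inter> C))"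
    using assms(3,4) union by (metis finite_Un)+
  from card_Un_Int[OF this] card_Un_Int[OF assms(3,4)] show ?thesis
    by (simp only: union inter)
qed

lemma nestedI: "sep_le (A, B) (C, D) \<Longrightarrow> nested {A, B} {C, D}"
  unfolding nested_def by blast

lemma nested_sym:
  assumes "nested r s"
  shows "nested s r"
proof -
  obtain A B C D where "r = {B, A}" "s = {D, C}" "sep_le (A, B) (C, D)"
    using assms unfolding nested_def by (metis insert_commute)
  then show ?thesis using nestedI[of D C B A] by simp
qed

lemma profile_separation: "profile V E k P \<Longrightarrow> s \<in> P \<Longrightarrow> separation V E s"
  by (simp add: profile_def)

lemma profile_sep_order: "profile V E k P \<Longrightarrow> s \<in> P \<Longrightarrow> sep_order s < k"
  by (simp add: profile_def)

lemma profile_orients: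
  assumes "profile V E k P" "separation V E (A, B)" "sep_order (A, B) < k"
  shows "(A, B) \<in> P \<or> (B, A) \<in> P"
proof -
  have "\<exists>!s. s \<in> {(A, B), (B, A)} \<and> s \<in> P"
    using assms unfolding profile_def by presburger
  then show ?thesis by blast
qed

lemma profile_consistent:
  "profile V E k P \<Longrightarrow> (A, B) \<in> P \<Longrightarrow> (C, D) \<in> P \<Longrightarrow> {A, B} \<noteq> {C, D} \<Longrightarrow> \<not> (B \<subseteq> C \<and> D \<subseteq> A)"
  unfolding profile_def by (metis sep_le.simps)

lemma profile_not_inverse_join:
  "profile V E k P \<Longrightarrow> (A, B) \<in> P \<Longrightarrow> (C, D) \<in> P \<Longrightarrow> (B \<inter> D, A \<union> C) \<notin> P"
  unfolding profile_def by presburger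

section \<open>Thinly splintering families\<close>

definition corner :: "('x \<Rightarrow> 'x \<Rightarrow> bool) \<Rightarrow> 'x set \<Rightarrow> 'x \<Rightarrow> 'x \<Rightarrow> 'x \<Rightarrow> bool" where
  "corner crosses U x y z \<longleftrightarrow> (\<forall>s\<in>U. crosses s z \<longrightarrow> crosses s x \<or> crosses s y)"

definition crossing_number :: "('x \<Rightarrow> nat) \<Rightarrow> ('x \<Rightarrow> 'x \<Rightarrow> bool) \<Rightarrow> 'x set \<Rightarrow> 'x \<Rightarrow> nat" where
  "crossing_number rank crosses U x = card {y \<in> U. rank y = rank x \<and> crosses x y}"

locale thinly_splintering =
  fixes \<A> :: "'x set set" and rank :: "'x \<Rightarrow> nat" and crosses :: "'x \<Rightarrow> 'x \<Rightarrow> bool"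
  assumes crosses_sym: "crosses x y \<Longrightarrow> crosses y x"
    and nonempty: "A \<in> \<A> \<Longrightarrow> A \<noteq> {}"
    and rank_eq: "A \<in> \<A> \<Longrightarrow> x \<in> A \<Longrightarrow> y \<in> A \<Longrightarrow> rank x = rank y"
    and finite_crossings: "x \<in> \<Union>\<A> \<Longrightarrow> finite {y \<in> \<Union>\<A>. rank y \<le> rank x \<and> crosses x y}"
    and splinter_less:
      "A \<in> \<A> \<Longrightarrow> B \<in> \<A> \<Longrightarrow> x \<in> A \<Longrightarrow> y \<in> B \<Longrightarrow> rank x < rank y \<Longrightarrow> crosses x y \<Longrightarrow>
        \<exists>z\<in>B. \<not> crosses z x \<and> corner crosses (\<Union>\<A>) x y z"
    and splinter_equal:
      "A \<in> \<A> \<Longrightarrow> B \<in> \<A> \<Longrightarrow> x \<in> A \<Longrightarrow> y \<in> B \<Longrightarrow> rank x = rank y \<Longrightarrow> crosses x y \<Longrightarrow>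
        \<exists>z. corner crosses (\<Union>\<A>) x y z \<and>
          (z \<in> A \<and> crossing_number rank crosses (\<Union>\<A>) z < crossing_number rank crosses (\<Union>\<A>) x \<or>
           z \<in> B \<and> crossing_number rank crosses (\<Union>\<A>) z < crossing_number rank crosses (\<Union>\<A>) y)"
begin

definition uncrossed :: "'x set \<Rightarrow> 'x \<Rightarrow> bool" where
  "uncrossed M x \<longleftrightarrow> (\<forall>y\<in>M. \<not> crosses x y)"

definition layer :: "'x set \<Rightarrow> nat \<Rightarrow> 'x set" where
  "layer M k = {x. rank x = k \<and>
    (\<exists>A\<in>\<A>. is_arg_min (crossing_number rank crosses (\<Union>\<A>)) (\<lambda>z. z \<in> A \<and> uncrossed M z) x)}"

primrec stage :: "nat \<Rightarrow> 'x set" where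
  "stage 0 = {}"
| "stage (Suc k) = stage k \<union> layer (stage k) k"

lemma corner_uncrossed:
  assumes "corner crosses (\<Union>\<A>) x y z" "M \<subseteq> \<Union>\<A>" "uncrossed M x" "uncrossed M y"
  shows "uncrossed M z"
  unfolding uncrossed_def
proof
  fix s assume "s \<in> M"
  then have "\<not> crosses s x" "\<not> crosses s y"
    using assms(3,4) crosses_sym unfolding uncrossed_def by blast+
  then have "\<not> crosses s z"
    using assms(1,2) \<open>s \<in> M\<close> unfolding corner_def by blast
  then show "\<not> crosses z s" using crosses_sym by blast
qed

lemma layer_uncrossed: "x \<in> layer M k \<Longrightarrow> uncrossed M x"
  unfolding layer_def is_arg_min_def by blast

lemma layer_noncrossing:
  assumes "M \<subseteq> \<Union>\<A>" and x: "x \<in> layer M k" and y: "y \<in> layer M k"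
  shows "\<not> crosses x y"
proof
  assume "crosses x y"
  let ?cn = "crossing_number rank crosses (\<Union>\<A>)"
  obtain A B where "A \<in> \<A>" "B \<in> \<A>"
    and minimal_x: "is_arg_min ?cn (\<lambda>z. z \<in> A \<and> uncrossed M z) x"
    and minimal_y: "is_arg_min ?cn (\<lambda>z. z \<in> B \<and> uncrossed M z) y"
    using x y unfolding layer_def by blast
  moreover have "rank x = rank y"
    using x y unfolding layer_def by simp
  ultimately obtain z where z: "corner crosses (\<Union>\<A>) x y z"
    and smaller: "z \<in> A \<and> ?cn z < ?cn x \<or> z \<in> B \<and> ?cn z < ?cn y"
    using splinter_equal[of A B x y] \<open>crosses x y\<close> unfolding is_arg_min_def by blast
  have "uncrossed M z"
    using corner_uncrossed[OF z \<open>M \<subseteq> \<Union>\<A>\<close>] x y by (simp add: layer_uncrossed)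
  then show False
    using smaller minimal_x minimal_y unfolding is_arg_min_def by blast
qed

lemma stage_subset: "stage k \<subseteq> \<Union>\<A>"
  by (induction k) (auto simp: layer_def is_arg_min_def)

lemma stage_rank: "x \<in> stage k \<Longrightarrow> rank x < k"
  by (induction k) (auto simp: layer_def)

lemma stage_noncrossing: "x \<in> stage k \<Longrightarrow> y \<in> stage k \<Longrightarrow> \<not> crosses x y"
proof (induction k arbitrary: x y)
  case (Suc k)
  have "\<not> crosses u v" "\<not> crosses v u" if "u \<in> layer (stage k) k" "v \<in> stage k" for u v
    using layer_uncrossed[OF that(1)] that(2) crosses_sym unfolding uncrossed_def by blast+
  then show ?case
    using Suc layer_noncrossing[OF stage_subset] unfolding stage.simps by blast
qed simp

lemma stage_mono: "i \<le> j \<Longrightarrow> stage i \<subseteq> stage j"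
  by (rule lift_Suc_mono_le[of stage]) auto

lemma corner_crosses_fewer:
  assumes a: "a \<in> stage k" "crosses b a" and c: "\<not> crosses c a" "corner crosses (\<Union>\<A>) a b c"
  shows "{y \<in> stage k. crosses c y} \<subset> {y \<in> stage k. crosses b y}"
proof -
  have "crosses b y" if y: "y \<in> stage k" "crosses c y" for y
  proof -
    have "y \<in> \<Union>\<A>" using stage_subset y(1) by blast
    then have "crosses y a \<or> crosses y b"
      using c(2) crosses_sym[OF y(2)] unfolding corner_def by blast
    then show ?thesis using stage_noncrossing[OF y(1) a(1)] crosses_sym by blast
  qed
  then show ?thesis using a c(1) by blast
qed

lemma exists_uncrossed:
  assumes "A \<in> \<A>" and rank: "\<And>x. x \<in> A \<Longrightarrow> rank x = k"
  shows "\<exists>x\<in>A. uncrossed (stage k) x"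
proof -
  define crossed where "crossed x = {y \<in> stage k. crosses x y}" for x
  obtain x where "x \<in> A" using nonempty[OF assms(1)] by blast
  from is_arg_min_arg_min_nat[of "\<lambda>x. x \<in> A", OF this, of "\<lambda>x. card (crossed x)"]
  obtain b where "b \<in> A" and least: "\<And>x. x \<in> A \<Longrightarrow> \<not> card (crossed x) < card (crossed b)"
    unfolding is_arg_min_def by blast
  have "uncrossed (stage k) b"
  proof (rule ccontr)
    assume "\<not> uncrossed (stage k) b"
    then obtain a where a: "a \<in> stage k" "crosses b a" by (auto simp: uncrossed_def)
    then obtain B where "B \<in> \<A>" "a \<in> B" using stage_subset by blast
    moreover have "rank a < rank b" using stage_rank[OF a(1)] rank[OF \<open>b \<in> A\<close>] by simp
    ultimately obtain c where c: "c \<in> A" "\<not> crosses c a" "corner crosses (\<Union>\<A>) a b c"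
      using splinter_less[of B A a b] crosses_sym[OF a(2)] \<open>A \<in> \<A>\<close> \<open>b \<in> A\<close> by blast
    have "crossed b \<subseteq> {y \<in> \<Union>\<A>. rank y \<le> rank b \<and> crosses b y}"
      using stage_subset[of k] stage_rank[of _ k] rank[OF \<open>b \<in> A\<close>]
      by (auto simp: crossed_def less_imp_le)
    then have "finite (crossed b)"
      using finite_crossings[of b] \<open>A \<in> \<A>\<close> \<open>b \<in> A\<close> by (blast intro: finite_subset)
    then have "card (crossed c) < card (crossed b)"
      using corner_crosses_fewer[OF a c(2,3)] unfolding crossed_def by (rule psubset_card_mono)
    then show False using least[OF c(1)] by simp
  qed
  with \<open>b \<in> A\<close> show ?thesis by blast
qed

lemma stage_meets:
  assumes "A \<in> \<A>"
  shows "\<exists>k. A \<inter> stage k \<noteq> {}"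
proof -
  let ?cn = "crossing_number rank crosses (\<Union>\<A>)"
  obtain k where rank: "\<And>x. x \<in> A \<Longrightarrow> rank x = k" using rank_eq[OF assms] by blast
  obtain b where "b \<in> A \<and> uncrossed (stage k) b" using exists_uncrossed[OF assms rank] by blast
  from is_arg_min_arg_min_nat[of "\<lambda>x. x \<in> A \<and> uncrossed (stage k) x", OF this, of ?cn]
  obtain x where minimal: "is_arg_min ?cn (\<lambda>x. x \<in> A \<and> uncrossed (stage k) x) x" by blast
  then have "x \<in> A" by (simp add: is_arg_min_def)
  moreover have "x \<in> layer (stage k) k"
    using minimal rank[OF \<open>x \<in> A\<close>] assms unfolding layer_def by blast
  ultimately show ?thesis by (intro exI[of _ "Suc k"]) auto
qed

lemma exists_noncrossing_transversal:
  "\<exists>N\<subseteq>\<Union>\<A>. (\<forall>x\<in>N. \<forall>y\<in>N. \<not> crosses x y) \<and> (\<forall>A\<in>\<A>. A \<inter> N \<noteq> {})"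
proof (intro exI[of _ "\<Union>k. stage k"] conjI ballI)
  show "(\<Union>k. stage k) \<subseteq> \<Union>\<A>" using stage_subset by blast
  show "A \<inter> (\<Union>k. stage k) \<noteq> {}" if "A \<in> \<A>" for A using stage_meets[OF that] by blast
  show "\<not> crosses x y" if stages: "x \<in> (\<Union>k. stage k)" "y \<in> (\<Union>k. stage k)" for x y
  proof -
    obtain i j where "x \<in> stage i" "y \<in> stage j" using stages by blast
    then have "x \<in> stage (max i j)" "y \<in> stage (max i j)"
      using stage_mono[of i "max i j"] stage_mono[of j "max i j"] by auto
    then show ?thesis by (rule stage_noncrossing)
  qed
qed

end

section \<open>Components and separators\<close>

locale graph_separations =
  fixes V :: "'a set" and E :: "'a set set"
  assumes simple: "simple_graph V E"
begin

definition adj :: "'a set \<Rightarrow> ('a \<times> 'a) set" where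
  "adj X = {(u, v). {u, v} \<in> E \<and> u \<notin> X \<and> v \<notin> X}"

definition component :: "'a set \<Rightarrow> 'a \<Rightarrow> 'a set" where
  "component X u = {v. (u, v) \<in> (adj X)\<^sup>*}"

definition components :: "'a set \<Rightarrow> 'a set set" where
  "components X = component X ` (V - X)"

definition neighbourhood :: "'a set \<Rightarrow> 'a set" where
  "neighbourhood C = {y \<in> V - C. \<exists>c\<in>C. {y, c} \<in> E}"

definition full_components :: "'a set \<Rightarrow> 'a set set" where
  "full_components X = {C \<in> components X. neighbourhood C = X}"

definition tight :: "'a set \<Rightarrow> bool" where
  "tight X \<longleftrightarrow> finite X \<and> (\<exists>C\<in>full_components X. \<exists>D\<in>full_components X. C \<noteq> D)"

definition separates :: "'a set \<Rightarrow> 'a set \<Rightarrow> bool" where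
  "separates X Y \<longleftrightarrow> (\<exists>u\<in>Y - X. \<exists>v\<in>Y - X. v \<notin> component X u)"

definition cross :: "'a set \<Rightarrow> 'a set \<Rightarrow> bool" where
  "cross X Y \<longleftrightarrow> separates X Y \<or> separates Y X"

abbreviation cross_number :: "'a set set \<Rightarrow> 'a set \<Rightarrow> nat" where
  "cross_number \<equiv> crossing_number card cross"

lemma edge_in_V: "{u, v} \<in> E \<Longrightarrow> u \<in> V \<and> v \<in> V"
  using simple unfolding simple_graph_def by (metis doubleton_eq_iff)

lemma edge_sym: "{u, v} \<in> E \<Longrightarrow> {v, u} \<in> E"
  by (simp add: insert_commute)

lemma component_refl [simp]: "u \<in> component X u"
  by (simp add: component_def)

lemma component_sym:
  assumes "v \<in> component X u"
  shows "u \<in> component X v"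
proof -
  have "sym (adj X)" by (auto simp: sym_def adj_def insert_commute)
  then show ?thesis using assms by (auto simp: component_def dest: sym_rtrancl symD)
qed

lemma component_trans: "v \<in> component X u \<Longrightarrow> w \<in> component X v \<Longrightarrow> w \<in> component X u"
  by (auto simp: component_def)

lemma component_eq: "v \<in> component X u \<Longrightarrow> component X v = component X u"
  using component_trans component_sym by blast

lemma component_step:
  "v \<in> component X u \<Longrightarrow> {v, w} \<in> E \<Longrightarrow> v \<notin> X \<Longrightarrow> w \<notin> X \<Longrightarrow> w \<in> component X u"
  by (auto simp: component_def adj_def intro: rtrancl_into_rtrancl)

lemma component_induct [consumes 1, case_names refl step]:
  assumes "v \<in> component X u" and "Q u"
    and "\<And>v w. v \<in> component X u \<Longrightarrow> Q v \<Longrightarrow> {v, w} \<in> E \<Longrightarrow> v \<notin> X \<Longrightarrow> w \<notin> X \<Longrightarrow> w \<in> component X u \<Longrightarrow> Q w"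
  shows "Q v"
proof -
  have "(u, v) \<in> (adj X)\<^sup>*" using assms(1) by (simp add: component_def)
  then show ?thesis
  proof (induction rule: rtrancl_induct)
    case (step y z)
    then have "(u, z) \<in> (adj X)\<^sup>*" by auto
    with step assms(3)[of y z] show ?case by (auto simp: component_def adj_def)
  qed (rule assms(2))
qed

lemma component_disjoint_separator:
  assumes "u \<notin> X"
  shows "component X u \<inter> X = {}"
proof -
  have "v \<notin> X" if "v \<in> component X u" for v
    using that assms by (induction rule: component_induct) auto
  then show ?thesis by blast
qed

lemma component_subset_V: "u \<in> V \<Longrightarrow> component X u \<subseteq> V"
proof
  fix v assume "v \<in> component X u" "u \<in> V"
  then show "v \<in> V" by (induction rule: component_induct) (auto dest: edge_in_V)
qed

lemma component_antimono:
  assumes "X \<subseteq> Y"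
  shows "component Y u \<subseteq> component X u"
proof -
  have "adj Y \<subseteq> adj X" using assms by (auto simp: adj_def)
  then have "(adj Y)\<^sup>* \<subseteq> (adj X)\<^sup>*" by (rule rtrancl_mono)
  then show ?thesis by (auto simp: component_def)
qed

lemma component_subset_component:
  assumes "component X u \<inter> Y = {}"
  shows "component X u \<subseteq> component Y u"
proof
  fix v assume "v \<in> component X u"
  then show "v \<in> component Y u"
  proof (induction rule: component_induct)
    case (step v w)
    then show ?case using assms component_step[of v Y u w] by blast
  qed simp
qed

lemma component_subset_side:
  assumes "separation V E (A, B)" "u \<in> A - B"
  shows "component (A \<inter> B) u \<subseteq> A - B"
proof
  fix v assume "v \<in> component (A \<inter> B) u"
  then show "v \<in> A - B"
  proof (induction rule: component_induct)
    case (step v w)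
    then have "w \<in> A \<union> B" using edge_in_V assms(1) by auto
    with step assms(1) show ?case by auto
  qed (use assms in auto)
qed

lemma component_eq_if_mem: "C \<in> components X \<Longrightarrow> c \<in> C \<Longrightarrow> component X c = C"
  using component_eq unfolding components_def by blast

lemma components_nonempty: "C \<in> components X \<Longrightarrow> C \<noteq> {}"
  using component_refl unfolding components_def by blast

lemma components_subset: "C \<in> components X \<Longrightarrow> C \<subseteq> V - X"
  using component_subset_V component_disjoint_separator unfolding components_def by blast

lemma component_in_components: "u \<in> V - X \<Longrightarrow> component X u \<in> components X"
  by (simp add: components_def)

lemma components_disjnt: "pairwise disjnt (components X)"
  using component_eq_if_mem unfolding pairwise_def disjnt_def by blast

lemma components_neighbourhood:
  assumes "C \<in> components X"
  shows "neighbourhood C \<subseteq> X"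
proof
  fix y assume "y \<in> neighbourhood C"
  then obtain c where y: "y \<notin> C" "c \<in> C" "{c, y} \<in> E"
    using edge_sym unfolding neighbourhood_def by blast
  then show "y \<in> X"
    using component_step[of c X c y] component_eq_if_mem[OF assms y(2)] components_subset[OF assms]
    by auto
qed

lemma full_components_subset: "full_components X \<subseteq> components X"
  by (auto simp: full_components_def)

lemma full_component_separator_subset: "C \<in> full_components X \<Longrightarrow> X \<subseteq> V"
  by (auto simp: full_components_def neighbourhood_def)

lemma tight_subset_V: "tight X \<Longrightarrow> X \<subseteq> V"
  using full_component_separator_subset unfolding tight_def by blast

lemma full_components_disjnt: "pairwise disjnt (full_components X)"
  using pairwise_subset[OF components_disjnt full_components_subset] .

lemma full_component_attaches:
  assumes C: "C \<in> full_components X" and "C \<inter> Y = {}" "x \<in> X - Y" "c \<in> C"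
  shows "x \<in> component Y c"
proof -
  obtain d where d: "d \<in> C" "{d, x} \<in> E"
    using C \<open>x \<in> X - Y\<close> edge_sym unfolding full_components_def neighbourhood_def by blast
  have "component X c = C"
    using C \<open>c \<in> C\<close> full_components_subset component_eq_if_mem by blast
  then have "d \<in> component Y c"
    using component_subset_component[of X c Y] \<open>C \<inter> Y = {}\<close> d(1) by blast
  then show ?thesis
    by (rule component_step[OF _ d(2)]) (use assms d(1) in auto)
qed

lemma not_separates_if_full_component_avoids:
  assumes C: "C \<in> full_components X" and avoids: "C \<inter> Y = {}"
  shows "\<not> separates Y X"
proof -
  obtain c where "c \<in> C" using C components_nonempty full_components_subset by blast
  then have "component Y x = component Y c" if "x \<in> X - Y" for x
    using component_eq[OF full_component_attaches[OF C avoids that]] by blast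
  then have "y \<in> component Y x" if "x \<in> X - Y" "y \<in> X - Y" for x y
    using component_refl[of y Y] that by metis
  then show ?thesis unfolding separates_def by blast
qed

lemma component_avoids_if_not_separates:
  assumes "\<not> separates X Y" and C: "C \<in> components X" and D: "D \<in> components X" and "C \<noteq> D"
  shows "C \<inter> Y = {} \<or> D \<inter> Y = {}"
proof (rule ccontr)
  assume "\<not> ?thesis"
  then obtain c d where cd: "c \<in> C \<inter> Y" "d \<in> D \<inter> Y" by blast
  then have "c \<in> Y - X" "d \<in> Y - X"
    using components_subset[OF C] components_subset[OF D] by blast+
  then have "d \<in> component X c"
    using assms(1) unfolding separates_def by blast
  then show False
    using component_eq[of d X c] component_eq_if_mem[OF C] component_eq_if_mem[OF D] cd \<open>C \<noteq> D\<close>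
    by blast
qed

lemma full_component_avoids_if_not_separates:
  assumes "tight X" "\<not> separates X Y"
  obtains C where "C \<in> full_components X" "C \<inter> Y = {}"
proof -
  obtain C D where CD: "C \<in> full_components X" "D \<in> full_components X" "C \<noteq> D"
    using assms(1) unfolding tight_def by blast
  then have "C \<inter> Y = {} \<or> D \<inter> Y = {}"
    using component_avoids_if_not_separates[OF assms(2)] full_components_subset by blast
  then show ?thesis using that[OF CD(1)] that[OF CD(2)] by blast
qed

lemma separates_sym:
  assumes "tight X" "separates Y X"
  shows "separates X Y"
  using full_component_avoids_if_not_separates[OF assms(1)] not_separates_if_full_component_avoids
    assms(2) by metis

lemma cross_iff_separates: "tight X \<Longrightarrow> tight Y \<Longrightarrow> cross X Y \<longleftrightarrow> separates X Y"
  using separates_sym unfolding cross_def by blast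

lemma cross_sym: "cross X Y \<Longrightarrow> cross Y X"
  by (auto simp: cross_def)

lemma cross_full_component_meets:
  "tight X \<Longrightarrow> tight Y \<Longrightarrow> cross X Y \<Longrightarrow> C \<in> full_components Y \<Longrightarrow> C \<inter> X \<noteq> {}"
  using cross_iff_separates not_separates_if_full_component_avoids by blast

lemma not_cross_subset_Un:
  assumes tight: "tight X" "tight Y" "tight S" "tight Z" and "cross X Y"
    and not_cross: "\<not> cross S X" "\<not> cross S Y" and Z: "Z \<subseteq> X \<union> Y"
  shows "\<not> cross S Z"
proof -
  have "\<not> separates X S" using not_cross(1) by (simp add: cross_def)
  then obtain C where C: "C \<in> full_components X" "C \<inter> S = {}"
    by (rule full_component_avoids_if_not_separates[OF tight(1)])
  obtain y where y: "y \<in> C" "y \<in> Y - S"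
    using cross_full_component_meets[OF tight(2,1) cross_sym[OF \<open>cross X Y\<close>] C(1)] C(2) by blast
  have "z \<in> component S y" if "z \<in> Z - S" for z
  proof (cases "z \<in> X")
    case True
    then show ?thesis using full_component_attaches[OF C, of z y] that y by blast
  next
    case False
    then show ?thesis using not_cross(2) that Z y unfolding cross_def separates_def by blast
  qed
  then have "component S z = component S y" if "z \<in> Z - S" for z
    using component_eq that by blast
  then have "v \<in> component S u" if "u \<in> Z - S" "v \<in> Z - S" for u v
    using component_refl[of v S] that by metis
  then have "\<not> separates S Z" unfolding separates_def by blast
  then show ?thesis using cross_iff_separates[OF tight(3,4)] by blast
qed

lemma not_cross_subset_side:
  assumes "separation V E (A, B)" "\<not> cross (A \<inter> B) S" "S \<subseteq> V"
  shows "S \<subseteq> A \<or> S \<subseteq> B"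
proof (rule ccontr)
  assume "\<not> ?thesis"
  then obtain u v where uv: "u \<in> S" "u \<notin> A" "v \<in> S" "v \<notin> B" by blast
  with assms(1,3) have "v \<in> A - B" by auto
  moreover have "u \<in> component (A \<inter> B) v"
    using assms(2) uv unfolding cross_def separates_def by blast
  ultimately show False using component_subset_side[OF assms(1), of v] uv by blast
qed

definition minimal_separators :: "'a set \<Rightarrow> 'a \<Rightarrow> 'a \<Rightarrow> nat \<Rightarrow> 'a set set" where
  "minimal_separators F u v n =
    {Y. finite Y \<and> card Y = n \<and> Y \<inter> F = {} \<and> u \<notin> F \<union> Y \<and> v \<notin> component (F \<union> Y) u \<and>
      v \<notin> F \<union> Y \<and> Y \<subseteq> neighbourhood (component (F \<union> Y) u) \<inter> neighbourhood (component (F \<union> Y) v)}"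

lemma component_finite_witness:
  assumes "v \<in> component F u"
  shows "\<exists>p. finite p \<and> (\<forall>Y. p \<inter> Y = {} \<longrightarrow> v \<in> component (F \<union> Y) u)"
  using assms
proof (induction rule: component_induct)
  case refl
  show ?case by (intro exI[of _ "{}"]) auto
next
  case (step v w)
  then obtain p where p: "finite p" "\<And>Y. p \<inter> Y = {} \<Longrightarrow> v \<in> component (F \<union> Y) u" by blast
  have "w \<in> component (F \<union> Y) u" if "insert v (insert w p) \<inter> Y = {}" for Y
    using component_step[of v "F \<union> Y" u w] p(2)[of Y] step.hyps that by simp
  then show ?case using p(1) by (intro exI[of _ "insert v (insert w p)"]) simp
qed

lemma minimal_separators_connected:
  assumes "Y \<in> minimal_separators F u v n" "Y \<noteq> {}"
  shows "v \<in> component F u"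
proof -
  obtain y where "y \<in> Y" using \<open>Y \<noteq> {}\<close> by blast
  have reach: "y \<in> component F w" if w: "w \<notin> F \<union> Y" "y \<in> neighbourhood (component (F \<union> Y) w)" for w
  proof -
    obtain a where a: "a \<in> component (F \<union> Y) w" "{a, y} \<in> E"
      using w(2) edge_sym unfolding neighbourhood_def by blast
    have "a \<in> component F w" "a \<notin> F"
      using a(1) component_antimono[of F "F \<union> Y" w] component_disjoint_separator[OF w(1)]
      by blast+
    moreover have "y \<notin> F" using assms(1) \<open>y \<in> Y\<close> unfolding minimal_separators_def by blast
    ultimately show ?thesis using component_step[OF _ a(2)] by blast
  qed
  have "y \<in> component F u" "y \<in> component F v"
    using reach[of u] reach[of v] assms(1) \<open>y \<in> Y\<close> unfolding minimal_separators_def by blast+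
  then show ?thesis using component_trans component_sym by blast
qed

lemma minimal_separators_nonempty: "Y \<in> minimal_separators F u v (Suc n) \<Longrightarrow> Y \<noteq> {}"
  by (auto simp only: minimal_separators_def mem_Collect_eq card.empty)

lemma minimal_separators_delete:
  assumes "Y \<in> minimal_separators F u v (Suc n)" "y \<in> Y"
  shows "Y - {y} \<in> minimal_separators (insert y F) u v n"
proof -
  have "insert y F \<union> (Y - {y}) = F \<union> Y" using assms(2) by blast
  then show ?thesis using assms unfolding minimal_separators_def by auto
qed

text \<open>The induction deletes a vertex that a minimal separator of \<open>u\<close> and \<open>v\<close> shares with a
  fixed path between them; \<open>F\<close> collects the vertices deleted so far.\<close>

lemma finite_minimal_separators: "finite (minimal_separators F u v n)"
proof (induction n arbitrary: F)
  case 0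
  have "minimal_separators F u v 0 \<subseteq> {{}}"
    using card_0_eq unfolding minimal_separators_def by blast
  then show ?case by (rule finite_subset) simp
next
  case (Suc n)
  show ?case
  proof (cases "v \<in> component F u")
    case False
    then have "minimal_separators F u v (Suc n) = {}"
      using minimal_separators_connected minimal_separators_nonempty by blast
    then show ?thesis by simp
  next
    case True
    obtain p where p: "finite p" "\<And>Y. p \<inter> Y = {} \<Longrightarrow> v \<in> component (F \<union> Y) u"
      using component_finite_witness[OF True] by blast
    have "minimal_separators F u v (Suc n) \<subseteq>
        (\<Union>y\<in>p. insert y ` minimal_separators (insert y F) u v n)"
    proof
      fix Y assume Y: "Y \<in> minimal_separators F u v (Suc n)"
      obtain y where y: "y \<in> p" "y \<in> Y"
        using p(2)[of Y] Y unfolding minimal_separators_def by blast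
      then have "Y = insert y (Y - {y})" by blast
      then show "Y \<in> (\<Union>y\<in>p. insert y ` minimal_separators (insert y F) u v n)"
        using minimal_separators_delete[OF Y y(2)] y(1) by blast
    qed
    then show ?thesis by (rule finite_subset) (simp add: p(1) Suc)
  qed
qed

lemma finite_cross:
  assumes X: "tight X"
  shows "finite {Y. tight Y \<and> card Y \<le> n \<and> cross X Y}"
proof -
  have covered:
    "{Y. tight Y \<and> card Y \<le> n \<and> cross X Y} \<subseteq> (\<Union>u\<in>X. \<Union>v\<in>X. \<Union>m\<le>n. minimal_separators {} u v m)"
  proof
    fix Y assume "Y \<in> {Y. tight Y \<and> card Y \<le> n \<and> cross X Y}"
    then have Y: "tight Y" "card Y \<le> n" "cross X Y" by simp_all
    obtain C D where CD: "C \<in> full_components Y" "D \<in> full_components Y" "C \<noteq> D"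
      using Y(1) unfolding tight_def by blast
    then obtain u v where uv: "u \<in> C \<inter> X" "v \<in> D \<inter> X"
      using cross_full_component_meets[OF X Y(1,3)] by blast
    have components: "C \<in> components Y" "D \<in> components Y"
        "neighbourhood C = Y" "neighbourhood D = Y"
      using CD unfolding full_components_def by simp_all
    then have eq: "component Y u = C" "component Y v = D"
      using component_eq_if_mem uv by blast+
    moreover have "v \<notin> C"
      using component_eq_if_mem[OF components(1), of v] eq(2) CD(3) by blast
    moreover have "u \<notin> Y" "v \<notin> Y"
      using uv components_subset[OF components(1)] components_subset[OF components(2)] by blast+
    ultimately have "Y \<in> minimal_separators {} u v (card Y)"
      using components(3,4) Y(1) unfolding minimal_separators_def tight_def by simp
    then show "Y \<in> (\<Union>u\<in>X. \<Union>v\<in>X. \<Union>m\<le>n. minimal_separators {} u v m)" using uv Y(2) by blast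
  qed
  show ?thesis
    by (rule finite_subset[OF covered])
      (use X finite_minimal_separators in \<open>simp add: tight_def\<close>)
qed

section \<open>Corners of tight separations\<close>

lemma separation_towards:
  assumes "W \<subseteq> V" "X \<subseteq> V" "neighbourhood W \<subseteq> X"
  shows "separation V E (V - W, W \<union> X)"
  using assms unfolding neighbourhood_def by auto

definition tight_separation :: "'a set \<Rightarrow> 'a set \<Rightarrow> bool" where
  "tight_separation A B \<longleftrightarrow> separation V E (A, B) \<and> finite (A \<inter> B) \<and>
    (\<exists>C\<in>full_components (A \<inter> B). C \<subseteq> A - B) \<and> (\<exists>D\<in>full_components (A \<inter> B). D \<subseteq> B - A)"

lemma tight_separation_separator:
  assumes "tight_separation A B"
  shows "tight (A \<inter> B)"
proof -
  obtain C D where CD: "C \<in> full_components (A \<inter> B)" "C \<subseteq> A - B"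
      "D \<in> full_components (A \<inter> B)" "D \<subseteq> B - A"
    using assms unfolding tight_separation_def by blast
  have "C \<noteq> {}" using CD(1) components_nonempty full_components_subset by blast
  then have "C \<noteq> D" using CD(2,4) by blast
  then show ?thesis using assms CD(1,3) unfolding tight_separation_def tight_def by blast
qed

lemma tight_separation_side_not_cross:
  assumes tight: "tight_separation A B" "tight S" and side: "S \<subseteq> A \<or> S \<subseteq> B"
  shows "\<not> cross S (A \<inter> B)"
proof -
  obtain C where "C \<in> full_components (A \<inter> B)" "C \<inter> S = {}"
    using tight(1) side unfolding tight_separation_def by blast
  then have "\<not> separates S (A \<inter> B)" by (rule not_separates_if_full_component_avoids)
  then show ?thesis
    using cross_iff_separates[OF tight(2) tight_separation_separator[OF tight(1)]] by blast
qed

lemma cross_both_opposite_corners: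
  assumes sep: "separation V E (A, B)" "separation V E (C, D)"
    and corners: "tight_separation (A \<union> C) (B \<inter> D)" "tight_separation (B \<union> D) (A \<inter> C)"
    and S: "tight S" "cross S ((A \<union> C) \<inter> (B \<inter> D))" "cross S ((B \<union> D) \<inter> (A \<inter> C))"
  shows "cross (A \<inter> B) S \<and> cross (C \<inter> D) S"
proof -
  have "\<not> S \<subseteq> A \<union> C" "\<not> S \<subseteq> B \<union> D"
    using tight_separation_side_not_cross[OF corners(1) S(1)]
      tight_separation_side_not_cross[OF corners(2) S(1)] S(2,3) by blast+
  then show ?thesis
    using not_cross_subset_side[OF sep(1)] not_cross_subset_side[OF sep(2)]
      tight_subset_V[OF S(1)] by blast
qed

lemma cross_number_opposite_corners:
  assumes \<T>: "\<And>S. S \<in> \<T> \<Longrightarrow> tight S"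
    and sep: "separation V E (A, B)" "separation V E (C, D)"
    and crossing: "A \<inter> B \<in> \<T>" "C \<inter> D \<in> \<T>" "cross (A \<inter> B) (C \<inter> D)"
    and corners: "tight_separation (A \<union> C) (B \<inter> D)" "tight_separation (B \<union> D) (A \<inter> C)"
    and card: "card (A \<inter> B) = k" "card (C \<inter> D) = k"
      "card ((A \<union> C) \<inter> (B \<inter> D)) = k" "card ((B \<union> D) \<inter> (A \<inter> C)) = k"
  shows "cross_number \<T> ((A \<union> C) \<inter> (B \<inter> D)) +
      cross_number \<T> ((B \<union> D) \<inter> (A \<inter> C)) <
    cross_number \<T> (A \<inter> B) + cross_number \<T> (C \<inter> D)"
proof -
  define crossings where "crossings Z = {S \<in> \<T>. card S = k \<and> cross Z S}" for Z
  define X Y Z Z' where separators: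
    "X = A \<inter> B" "Y = C \<inter> D" "Z = (A \<union> C) \<inter> (B \<inter> D)" "Z' = (B \<union> D) \<inter> (A \<inter> C)"
  have tight: "tight X" "tight Y" "tight Z" "tight Z'"
    using \<T> crossing corners tight_separation_separator unfolding separators by blast+
  have "Z \<subseteq> X \<union> Y" "Z' \<subseteq> X \<union> Y" unfolding separators by blast+
  then have "cross X S \<or> cross Y S" if "S \<in> \<T>" "cross Z S \<or> cross Z' S" for S
    using not_cross_subset_Un[OF tight(1,2) \<T>[OF that(1)] tight(3)]
      not_cross_subset_Un[OF tight(1,2) \<T>[OF that(1)] tight(4)]
      crossing(3) that(2) cross_sym unfolding separators by blast
  then have "crossings Z \<union> crossings Z' \<subseteq> crossings X \<union> crossings Y"
    unfolding crossings_def by blast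
  moreover have "X \<in> crossings Y"
    using crossing card(1) cross_sym unfolding crossings_def separators by blast
  moreover have "X \<notin> crossings Z \<union> crossings Z'"
    using tight_separation_side_not_cross[OF corners(1) tight(1)]
      tight_separation_side_not_cross[OF corners(2) tight(1)] cross_sym
    unfolding crossings_def separators by blast
  moreover have "crossings Z \<inter> crossings Z' \<subseteq> crossings X \<inter> crossings Y"
    using cross_both_opposite_corners[OF sep corners \<T>] cross_sym
    unfolding crossings_def separators by blast
  moreover have "finite (crossings W)" if "tight W" for W
    by (rule finite_subset[OF _ finite_cross[OF that, of k]]) (auto simp: crossings_def \<T>)
  ultimately have
    "card (crossings Z) + card (crossings Z') < card (crossings X) + card (crossings Y)"
    using tight by (intro card_add_less_if_Un_psubset) blast+
  then show ?thesis
    using card unfolding crossings_def separators crossing_number_def by simp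
qed

section \<open>Regular profiles\<close>

definition regular_profile :: "'a osep set \<Rightarrow> bool" where
  "regular_profile P \<longleftrightarrow> (\<exists>k. profile V E k P) \<and> regular V P"

definition regular_bounded_profile :: "'a osep set \<Rightarrow> bool" where
  "regular_bounded_profile P \<longleftrightarrow> bounded_profile V E P \<and> regular V P"

lemma regular_bounded_profile_regular: "regular_bounded_profile P \<Longrightarrow> regular_profile P"
  unfolding regular_bounded_profile_def regular_profile_def bounded_profile_def by blast

lemma regular_profile_separation:
  "regular_profile P \<Longrightarrow> (A, B) \<in> P \<Longrightarrow> separation V E (A, B)"
  using profile_separation unfolding regular_profile_def by blast

lemma regular_profile_finite:
  assumes "regular_profile P" "(A, B) \<in> P"
  shows "finite (A \<inter> B)"
proof -
  obtain k where "sep_order (A, B) < k"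
    using assms profile_sep_order unfolding regular_profile_def by blast
  then show ?thesis by (auto split: if_splits)
qed

lemma regular_profile_not_V: "regular_profile P \<Longrightarrow> (V, B) \<notin> P"
  unfolding regular_profile_def regular_def by blast

text \<open>The index of the profile stays implicit: a member of at least the same order takes its
  place.\<close>

lemma regular_profile_orients:
  assumes "regular_profile P" "(A, B) \<in> P"
    and sep: "separation V E (C, D)" "finite (C \<inter> D)" "card (C \<inter> D) \<le> card (A \<inter> B)"
  shows "(C, D) \<in> P \<or> (D, C) \<in> P"
proof -
  obtain k where k: "profile V E k P"
    using assms(1) unfolding regular_profile_def by blast
  then have "sep_order (A, B) < k" using profile_sep_order assms(2) by blast
  moreover have "sep_order (C, D) \<le> sep_order (A, B)"
    using sep regular_profile_finite[OF assms(1,2)] by simp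
  ultimately have "sep_order (C, D) < k" by (rule le_less_trans[rotated])
  then show ?thesis by (rule profile_orients[OF k sep(1)])
qed

lemma regular_profile_join:
  assumes P: "regular_profile P" and mem: "(A, B) \<in> P" "(C, D) \<in> P"
    and card: "card ((A \<union> C) \<inter> (B \<inter> D)) \<le> card (A \<inter> B)"
  shows "(A \<union> C, B \<inter> D) \<in> P"
proof -
  have "finite ((A \<union> C) \<inter> (B \<inter> D))"
    using regular_profile_finite[OF P mem(1)] regular_profile_finite[OF P mem(2)]
    by (rule finite_subset[rotated, OF finite_UnI]) blast
  moreover have "separation V E (A \<union> C, B \<inter> D)"
    using mem regular_profile_separation[OF P] separation_join by blast
  ultimately have "(A \<union> C, B \<inter> D) \<in> P \<or> (B \<inter> D, A \<union> C) \<in> P"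
    using regular_profile_orients[OF P mem(1)] card by blast
  moreover have "(B \<inter> D, A \<union> C) \<notin> P"
    using P mem profile_not_inverse_join unfolding regular_profile_def by blast
  ultimately show ?thesis by blast
qed

lemma regular_profile_not_cover:
  assumes P: "regular_profile P" and mem: "(A, B) \<in> P" "(C, D) \<in> P"
    and card: "card (B \<inter> D) \<le> card (A \<inter> B)"
  shows "A \<union> C \<noteq> V"
proof
  assume "A \<union> C = V"
  moreover have "B \<subseteq> V" using regular_profile_separation[OF P mem(1)] by auto
  ultimately have "(A \<union> C) \<inter> (B \<inter> D) = B \<inter> D" by blast
  then have "(A \<union> C, B \<inter> D) \<in> P" using regular_profile_join[OF P mem] card by simp
  then show False using regular_profile_not_V[OF P] \<open>A \<union> C = V\<close> by simp
qed

lemma regular_profile_down: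
  assumes P: "regular_profile P" and AB: "(A, B) \<in> P"
    and sep: "separation V E (C, D)" "finite (C \<inter> D)" "card (C \<inter> D) \<le> card (A \<inter> B)"
    and le: "C \<subseteq> A" "B \<subseteq> D"
  shows "(C, D) \<in> P"
proof (rule ccontr)
  assume "(C, D) \<notin> P"
  then have DC: "(D, C) \<in> P" using regular_profile_orients[OF P AB sep] by blast
  then have "{A, B} = {D, C}"
    using P AB le profile_consistent unfolding regular_profile_def by blast
  then consider (inverse) "A = D" | (equal) "A = C" "B = D" by (auto simp: doubleton_eq_iff)
  then show False
  proof cases
    case inverse
    then have "A = V" using sep(1) le by auto
    then show False using regular_profile_not_V[OF P] AB by blast
  next
    case equal
    then show False using \<open>(C, D) \<notin> P\<close> AB by blast
  qed
qed

lemma regular_profile_shrink: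
  assumes P: "regular_profile P" and AB: "(A, B) \<in> P"
    and sep: "separation V E (A, C)" and "C \<subseteq> B"
  shows "(A, C) \<in> P"
proof (rule ccontr)
  assume "(A, C) \<notin> P"
  have "A \<inter> C \<subseteq> A \<inter> B" using \<open>C \<subseteq> B\<close> by blast
  then have "finite (A \<inter> C)" "card (A \<inter> C) \<le> card (A \<inter> B)"
    using regular_profile_finite[OF P AB] by (simp_all only: finite_subset card_mono)
  then have "(C, A) \<in> P" using regular_profile_orients[OF P AB sep] \<open>(A, C) \<notin> P\<close> by blast
  then have "A \<union> C \<noteq> V" using regular_profile_not_cover[OF P AB] by (simp add: Int_commute)
  then show False using sep by simp
qed

section \<open>Bounded profiles select components\<close>

definition union_of_components :: "'a set \<Rightarrow> 'a set \<Rightarrow> bool" where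
  "union_of_components X W \<longleftrightarrow> W \<subseteq> V - X \<and> neighbourhood W \<subseteq> X"

definition components_within :: "'a set \<Rightarrow> 'a set \<Rightarrow> 'a set" where
  "components_within X S = {u \<in> V - X. component X u \<subseteq> S}"

lemma union_of_components_empty: "union_of_components X {}"
  by (simp add: union_of_components_def neighbourhood_def)

lemma union_of_components_Diff:
  assumes "union_of_components X W"
  shows "union_of_components X (V - X - W)"
  using assms edge_sym unfolding union_of_components_def neighbourhood_def by blast

lemma union_of_components_Int:
  assumes "union_of_components X W" "union_of_components X W'"
  shows "union_of_components X (W \<inter> W')"
  using assms unfolding union_of_components_def neighbourhood_def by blast

lemma union_of_components_component: "C \<in> components X \<Longrightarrow> union_of_components X C"
  using components_subset components_neighbourhood unfolding union_of_components_def by blast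

lemma union_of_components_within: "union_of_components X (components_within X S)"
proof -
  have "y \<in> X" if y: "y \<in> V" "y \<notin> components_within X S"
    and c: "c \<in> components_within X S" and edge: "{y, c} \<in> E" for y c
  proof (rule ccontr)
    assume "y \<notin> X"
    then have "y \<in> component X c"
      using component_step[OF component_refl edge_sym[OF edge]] c
      by (simp add: components_within_def)
    then have "component X y \<subseteq> S"
      using component_eq[of y X c] c by (simp add: components_within_def)
    then show False using y \<open>y \<notin> X\<close> by (simp add: components_within_def)
  qed
  then show ?thesis
    unfolding union_of_components_def neighbourhood_def by (auto simp: components_within_def)
qed

lemma components_within_Int:
  "components_within X S \<inter> components_within X T = components_within X (S \<inter> T)"
  by (auto simp: components_within_def)

lemma components_within_empty: "components_within X {} = {}"
  using component_refl unfolding components_within_def by blast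

lemma components_within_subset: "components_within X S \<subseteq> S"
  using component_refl unfolding components_within_def by blast

lemma components_within_sides:
  assumes "separation V E (C, D)"
  shows "components_within X (V - C \<inter> D) \<subseteq>
    components_within X (D - C) \<union> components_within X (C - D)"
proof
  fix u assume u: "u \<in> components_within X (V - C \<inter> D)"
  then have "component X u \<inter> (C \<inter> D) = {}" unfolding components_within_def by blast
  then have avoids: "component X u \<subseteq> component (C \<inter> D) u" by (rule component_subset_component)
  have "u \<in> C - D \<or> u \<in> D - C" using u components_within_subset assms by auto
  then have "component (C \<inter> D) u \<subseteq> C - D \<or> component (D \<inter> C) u \<subseteq> D - C"
    using component_subset_side[OF assms] component_subset_side[OF separation_swap[OF assms]]
    by blast
  then have "component X u \<subseteq> C - D \<or> component X u \<subseteq> D - C"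
    using avoids by (auto simp: Int_commute)
  then show "u \<in> components_within X (D - C) \<union> components_within X (C - D)"
    using u by (auto simp: components_within_def)
qed

text \<open>If \<open>P\<close> chooses no component of \<open>G - X\<close>, then it induces a non-principal ultrafilter on
  the set of these components, and this ultrafilter orients all separations of finite order.\<close>

context
  fixes P :: "'a osep set" and A B X :: "'a set"
  assumes P: "regular_profile P" and AB: "(A, B) \<in> P" and X: "X = A \<inter> B"
    and no_component: "C \<in> components X \<Longrightarrow> (V - C, C \<union> X) \<notin> P"
begin

definition large :: "'a set \<Rightarrow> bool" where
  "large W \<longleftrightarrow> union_of_components X W \<and> (V - W, W \<union> X) \<in> P"

definition ultrafilter_profile :: "'a osep set" where
  "ultrafilter_profile =
    {(C, D). separation V E (C, D) \<and> finite (C \<inter> D) \<and> large (components_within X (D - C))}"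

lemma separator_subset_V: "X \<subseteq> V"
  using regular_profile_separation[OF P AB] X by auto

lemma finite_separator: "finite X"
  using regular_profile_finite[OF P AB] X by simp

lemma towards_union_of_components:
  assumes "union_of_components X W"
  shows "separation V E (V - W, W \<union> X)" and "(V - W) \<inter> (W \<union> X) = X"
  using assms separator_subset_V separation_towards[of W X] unfolding union_of_components_def
  by blast+

lemma large_or_large_Diff:
  assumes W: "union_of_components X W"
  shows "large W \<or> large (V - X - W)"
proof -
  have "(V - W, W \<union> X) \<in> P \<or> (W \<union> X, V - W) \<in> P"
    using regular_profile_orients[OF P AB] towards_union_of_components[OF W] finite_separator X
    by simp
  moreover have "V - (V - X - W) = W \<union> X" "(V - X - W) \<union> X = V - W"
    using W separator_subset_V unfolding union_of_components_def by blast+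
  ultimately show ?thesis
    using W union_of_components_Diff[OF W] unfolding large_def by simp
qed

lemma large_Int:
  assumes W: "large W" and W': "large W'"
  shows "large (W \<inter> W')"
proof -
  have union: "union_of_components X (W \<inter> W')"
    using W W' union_of_components_Int unfolding large_def by blast
  have eq: "(V - W) \<union> (V - W') = V - W \<inter> W'" "(W \<union> X) \<inter> (W' \<union> X) = (W \<inter> W') \<union> X" by blast+
  have "card (((V - W) \<union> (V - W')) \<inter> ((W \<union> X) \<inter> (W' \<union> X))) \<le> card ((V - W) \<inter> (W \<union> X))"
    using towards_union_of_components(2)[OF union] towards_union_of_components(2)[of W] W
    unfolding eq large_def by simp
  from regular_profile_join[OF P _ _ this] show ?thesis
    using W W' union unfolding large_def eq by blast
qed

lemma not_large_empty: "\<not> large {}"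
  using regular_profile_not_V[OF P] unfolding large_def by simp

lemma large_mono:
  assumes "large W" "union_of_components X W'" "W \<subseteq> W'"
  shows "large W'"
proof (rule ccontr)
  assume "\<not> large W'"
  then have "large (W \<inter> (V - X - W'))"
    using large_or_large_Diff[OF assms(2)] large_Int[OF assms(1)] by blast
  moreover have "W \<inter> (V - X - W') = {}" using assms(3) by blast
  ultimately show False using not_large_empty by simp
qed

lemma large_within_cofinite:
  assumes "finite S"
  shows "large (components_within X (V - S))"
  using assms
proof (induction S rule: finite_induct)
  case empty
  have "large (V - X)"
    using large_or_large_Diff[OF union_of_components_empty] not_large_empty by simp
  moreover have "V - X \<subseteq> components_within X (V - {})"
    using component_subset_V unfolding components_within_def by blast
  ultimately show ?case using large_mono union_of_components_within by blast
next
  case (insert s S)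
  have "large (components_within X (V - {s}))"
  proof (cases "s \<in> V - X")
    case True
    then have C: "component X s \<in> components X" by (rule component_in_components)
    then have "large (V - X - component X s)"
      using large_or_large_Diff union_of_components_component no_component
      unfolding large_def by blast
    moreover have "V - X - component X s \<subseteq> components_within X (V - {s})"
      using component_subset_V component_sym unfolding components_within_def by blast
    ultimately show ?thesis using large_mono union_of_components_within by blast
  next
    case False
    then have "components_within X (V - S) \<subseteq> components_within X (V - {s})"
      using component_subset_V component_disjoint_separator unfolding components_within_def by blast
    then show ?thesis using large_mono[OF insert.IH] union_of_components_within by blast
  qed
  moreover have "(V - S) \<inter> (V - {s}) = V - insert s S" by blast
  ultimately show ?case using large_Int[OF insert.IH] components_within_Int by metis
qed

lemma large_side:
  assumes "separation V E (C, D)" "finite (C \<inter> D)"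
  shows "large (components_within X (D - C)) \<or> large (components_within X (C - D))"
proof (rule ccontr)
  assume "\<not> ?thesis"
  then have "large (V - X - components_within X (D - C))"
    "large (V - X - components_within X (C - D))"
    using large_or_large_Diff[OF union_of_components_within] by blast+
  then have "large (components_within X (V - C \<inter> D) \<inter>
      ((V - X - components_within X (D - C)) \<inter> (V - X - components_within X (C - D))))"
    using large_Int large_within_cofinite[OF assms(2)] by blast
  moreover have "components_within X (V - C \<inter> D) \<inter>
      ((V - X - components_within X (D - C)) \<inter> (V - X - components_within X (C - D))) = {}"
    using components_within_sides[OF assms(1)] by blast
  ultimately show False using not_large_empty by simp
qed

lemma not_large_disjoint:
  assumes "S \<inter> T = {}"
  shows "\<not> (large (components_within X S) \<and> large (components_within X T))"
  using large_Int not_large_empty components_within_Int[of X S T] components_within_empty assms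
  by metis

lemma profile_ultrafilter_profile: "profile V E \<infinity> ultrafilter_profile"
  unfolding profile_def
proof (intro conjI allI impI ballI)
  fix s assume "s \<in> ultrafilter_profile"
  then show "separation V E s" "sep_order s < \<infinity>" by (auto simp: ultrafilter_profile_def)
next
  fix C D assume "separation V E (C, D) \<and> sep_order (C, D) < \<infinity>"
  then have CD: "separation V E (C, D)" "finite (C \<inter> D)" by (simp_all split: if_splits)
  moreover have DC: "separation V E (D, C)" "finite (D \<inter> C)"
    using separation_swap[OF CD(1)] CD(2) by (simp_all only: Int_commute)
  moreover have "\<not> (large (components_within X (D - C)) \<and> large (components_within X (C - D)))"
    by (rule not_large_disjoint) blast
  ultimately have "((C, D) \<in> ultrafilter_profile) \<noteq> ((D, C) \<in> ultrafilter_profile)"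
    using large_side[OF CD] unfolding ultrafilter_profile_def by blast
  then show "\<exists>!s. s \<in> {(C, D), (D, C)} \<and> s \<in> ultrafilter_profile" by blast
next
  fix C D C' D'
  assume mem: "(C, D) \<in> ultrafilter_profile \<and> (C', D') \<in> ultrafilter_profile \<and> {C, D} \<noteq> {C', D'}"
  show "\<not> sep_le (D, C) (C', D')"
  proof
    assume "sep_le (D, C) (C', D')"
    then have "(D - C) \<inter> (D' - C') = {}" by auto
    from not_large_disjoint[OF this] mem show False unfolding ultrafilter_profile_def by blast
  qed
next
  fix C D C' D'
  assume mem: "(C, D) \<in> ultrafilter_profile \<and> (C', D') \<in> ultrafilter_profile"
  show "(D \<inter> D', C \<union> C') \<notin> ultrafilter_profile"
  proof
    assume join: "(D \<inter> D', C \<union> C') \<in> ultrafilter_profile"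
    have "large (components_within X ((D - C) \<inter> (D' - C')))"
      using mem large_Int
      unfolding ultrafilter_profile_def components_within_Int[symmetric] by blast
    moreover have "large (components_within X ((C \<union> C') - (D \<inter> D')))"
      using join unfolding ultrafilter_profile_def by blast
    moreover have "(D - C) \<inter> (D' - C') \<inter> ((C \<union> C') - (D \<inter> D')) = {}" by blast
    ultimately show False using not_large_disjoint by blast
  qed
qed

lemma subset_ultrafilter_profile: "P \<subseteq> ultrafilter_profile"
proof (rule subrelI)
  fix C D assume CD: "(C, D) \<in> P"
  note sep = regular_profile_separation[OF P CD] regular_profile_finite[OF P CD]
  let ?W = "components_within X (C - D)"
  have "\<not> large ?W"
  proof
    assume W: "large ?W"
    have "?W \<subseteq> C - D" by (rule components_within_subset)
    then have "(V - ?W) \<union> C = V" "(?W \<union> X) \<inter> D \<subseteq> X" using sep(1) by auto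
    moreover have "(V - ?W) \<inter> (?W \<union> X) = X"
      by (rule towards_union_of_components(2)[OF union_of_components_within])
    ultimately show False
      using regular_profile_not_cover[OF P _ CD, of "V - ?W" "?W \<union> X"] W
        card_mono[OF finite_separator] unfolding large_def by simp
  qed
  then show "(C, D) \<in> ultrafilter_profile"
    using large_side[OF sep] sep unfolding ultrafilter_profile_def by blast
qed

end

lemma regular_bounded_profile_chooses_component:
  assumes P: "regular_bounded_profile P" and AB: "(A, B) \<in> P"
  shows "\<exists>C\<in>components (A \<inter> B). (V - C, C \<union> (A \<inter> B)) \<in> P"
proof (rule ccontr)
  assume "\<not> ?thesis"
  then have none: "(V - C, C \<union> (A \<inter> B)) \<notin> P" if "C \<in> components (A \<inter> B)" for C
    using that by blast
  note regular = regular_bounded_profile_regular[OF P]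
  have "\<exists>Q. profile V E \<infinity> Q \<and> P \<subseteq> Q"
    using profile_ultrafilter_profile[OF regular AB refl none]
      subset_ultrafilter_profile[OF regular AB refl none] by blast
  then show False using P unfolding regular_bounded_profile_def bounded_profile_def by blast
qed

section \<open>Efficient separations\<close>

definition efficient :: "'a osep set \<Rightarrow> 'a osep set \<Rightarrow> 'a set \<Rightarrow> 'a set \<Rightarrow> bool" where
  "efficient P P' A B \<longleftrightarrow> (A, B) \<in> P \<and> (B, A) \<in> P' \<and>
     (\<forall>C D. (C, D) \<in> P \<and> (D, C) \<in> P' \<longrightarrow> card (A \<inter> B) \<le> card (C \<inter> D))"

definition efficient_separators :: "'a osep set \<Rightarrow> 'a osep set \<Rightarrow> 'a set set" where
  "efficient_separators P P' = {A \<inter> B | A B. efficient P P' A B}"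

lemma efficient_swap: "efficient P P' A B \<Longrightarrow> efficient P' P B A"
  unfolding efficient_def by (metis Int_commute)

lemma efficient_mem: "efficient P P' A B \<Longrightarrow> (A, B) \<in> P"
  by (simp add: efficient_def)

lemma efficient_swap_mem: "efficient P P' A B \<Longrightarrow> (B, A) \<in> P'"
  by (simp add: efficient_def)

lemma efficient_card_le:
  "efficient P P' A B \<Longrightarrow> (C, D) \<in> P \<Longrightarrow> (D, C) \<in> P' \<Longrightarrow> card (A \<inter> B) \<le> card (C \<inter> D)"
  by (simp add: efficient_def)

lemma efficient_card_eq: "efficient P P' A B \<Longrightarrow> efficient P P' C D \<Longrightarrow> card (A \<inter> B) = card (C \<inter> D)"
  by (simp add: efficient_def le_antisym)

lemma efficient_separatorsI: "efficient P P' A B \<Longrightarrow> X = A \<inter> B \<Longrightarrow> X \<in> efficient_separators P P'"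
  unfolding efficient_separators_def by blast

lemma efficient_separators_commute: "efficient_separators P P' = efficient_separators P' P"
  unfolding efficient_separators_def using efficient_swap by (metis Int_commute)

lemma efficient_separators_card_eq:
  "X \<in> efficient_separators P P' \<Longrightarrow> Y \<in> efficient_separators P P' \<Longrightarrow> card X = card Y"
  unfolding efficient_separators_def using efficient_card_eq by blast

lemma efficient_efficiently_distinguishes:
  assumes P: "regular_profile P" and AB: "efficient P P' A B"
  shows "efficiently_distinguishes V E {A, B} P P'"
proof -
  have "distinguishes V E (A, B) P P'"
    using regular_profile_separation[OF P] efficient_mem[OF AB] efficient_swap_mem[OF AB]
    unfolding distinguishes_def by simp
  moreover have "sep_order (A, B) \<le> sep_order s" if s: "distinguishes V E s P P'" for s
  proof -
    obtain C D where "s = (C, D)" by fastforce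
    then have "(C, D) \<in> P \<and> (D, C) \<in> P' \<or> (D, C) \<in> P \<and> (C, D) \<in> P'"
      using s unfolding distinguishes_def by simp
    then have "card (A \<inter> B) \<le> card (C \<inter> D)"
      using efficient_card_le[OF AB] by (metis Int_commute)
    then show ?thesis
      using regular_profile_finite[OF P efficient_mem[OF AB]] \<open>s = (C, D)\<close> by simp
  qed
  ultimately show ?thesis unfolding efficiently_distinguishes_def by blast
qed

lemma distinguishable_efficient_separators:
  assumes "distinguishable V E P P'"
  shows "efficient_separators P P' \<noteq> {}"
proof -
  obtain s where s: "distinguishes V E s P P'"
    using assms unfolding distinguishable_def by blast
  then have "\<exists>t. t \<in> P \<and> prod.swap t \<in> P'"
    unfolding distinguishes_def by (metis swap_swap)
  then obtain t where "t \<in> P \<and> prod.swap t \<in> P'" by blast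
  from is_arg_min_arg_min_nat
    [of "\<lambda>t. t \<in> P \<and> prod.swap t \<in> P'", OF this, of "\<lambda>(A, B). card (A \<inter> B)"]
  obtain r where r: "is_arg_min (\<lambda>(A, B). card (A \<inter> B)) (\<lambda>t. t \<in> P \<and> prod.swap t \<in> P') r" by blast
  obtain A B where "r = (A, B)" by fastforce
  then have "efficient P P' A B"
    using r by (auto simp: is_arg_min_def efficient_def not_less)
  then show ?thesis unfolding efficient_separators_def by blast
qed

lemma efficient_orients:
  assumes P: "regular_profile P" and Q: "regular_profile Q"
    and AB: "efficient P P' A B" and CD: "efficient Q Q' C D" and le: "card (C \<inter> D) \<le> card (A \<inter> B)"
  shows "(C, D) \<in> P \<or> (D, C) \<in> P"
  using regular_profile_orients[OF P efficient_mem[OF AB] _ _ le] efficient_mem[OF CD]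
    regular_profile_separation[OF Q] regular_profile_finite[OF Q] by blast

lemma efficient_greater:
  assumes P: "regular_profile P" and P': "regular_profile P'" and AB: "efficient P P' A B"
    and CD: "(C, D) \<in> P" "A \<subseteq> C" "D \<subseteq> B" "card (C \<inter> D) \<le> card (A \<inter> B)"
  shows "efficient P P' C D"
proof -
  have "(D, C) \<in> P'"
    using regular_profile_down[OF P' efficient_swap_mem[OF AB]] CD
      separation_swap[OF regular_profile_separation[OF P CD(1)]] regular_profile_finite[OF P CD(1)]
    by (simp add: Int_commute)
  then show ?thesis
    using CD(1,4) efficient_card_le[OF AB] order_trans unfolding efficient_def by blast
qed

lemma efficient_join:
  assumes P: "regular_profile P" and P': "regular_profile P'" and AB: "efficient P P' A B"
    and CD: "(C, D) \<in> P" and card: "card ((A \<union> C) \<inter> (B \<inter> D)) \<le> card (A \<inter> B)"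
  shows "efficient P P' (A \<union> C) (B \<inter> D)"
  by (rule efficient_greater[OF P P' AB regular_profile_join[OF P efficient_mem[OF AB] CD card]])
    (use card in auto)

lemma chosen_component_side:
  assumes P: "regular_profile P" and AB: "(A, B) \<in> P"
    and C: "C \<in> components (A \<inter> B)" "(V - C, C \<union> (A \<inter> B)) \<in> P"
  shows "C \<subseteq> B - A"
proof -
  note sep = regular_profile_separation[OF P AB]
  have CV: "C \<subseteq> V - A \<inter> B" by (rule components_subset[OF C(1)])
  obtain u where u: "u \<in> C" using components_nonempty[OF C(1)] by blast
  then have component: "component (A \<inter> B) u = C" by (rule component_eq_if_mem[OF C(1)])
  have "u \<notin> A - B"
  proof
    assume "u \<in> A - B"
    then have "C \<subseteq> A - B" using component_subset_side[OF sep] component by blast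
    then have "(V - C) \<union> A = V" "(C \<union> (A \<inter> B)) \<inter> B = A \<inter> B"
      and "(V - C) \<inter> (C \<union> (A \<inter> B)) = A \<inter> B"
      using sep by auto
    then show False using regular_profile_not_cover[OF P C(2) AB] by simp
  qed
  then have "u \<in> B - A" using u CV sep by auto
  then show ?thesis
    using component_subset_side[OF separation_swap[OF sep], of u] component
    by (simp add: Int_commute)
qed

lemma efficient_full_component:
  assumes P: "regular_bounded_profile P" and P': "regular_profile P'"
    and AB: "efficient P P' A B"
  obtains C where "C \<in> full_components (A \<inter> B)" "C \<subseteq> B - A"
    "efficient P P' (V - C) (C \<union> (A \<inter> B))"
proof -
  note regular = regular_bounded_profile_regular[OF P] and mem = efficient_mem[OF AB]
  have sep: "A \<union> B = V" "finite (A \<inter> B)"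
    using regular_profile_separation[OF regular mem] regular_profile_finite[OF regular mem]
    by simp_all
  obtain C where C: "C \<in> components (A \<inter> B)" "(V - C, C \<union> (A \<inter> B)) \<in> P"
    using regular_bounded_profile_chooses_component[OF P mem] by blast
  have side: "C \<subseteq> B - A" by (rule chosen_component_side[OF regular mem C])
  define N where "N = neighbourhood C"
  have N: "N \<subseteq> A \<inter> B" using components_neighbourhood[OF C(1)] by (simp add: N_def)
  have inter: "(V - C) \<inter> (C \<union> N) = N" using N side sep(1) by blast
  have "separation V E (V - C, C \<union> N)"
    by (rule separation_towards) (use side N sep(1) N_def in auto)
  then have "(V - C, C \<union> N) \<in> P"
    by (rule regular_profile_shrink[OF regular C(2)]) (use N in blast)
  moreover have "A \<subseteq> V - C" "C \<union> N \<subseteq> B" using side N sep(1) by blast+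
  moreover have "card N \<le> card (A \<inter> B)" using card_mono[OF sep(2) N] .
  ultimately have efficient: "efficient P P' (V - C) (C \<union> N)"
    using efficient_greater[OF regular P' AB] inter by simp
  have "card N = card (A \<inter> B)" using efficient_card_eq[OF efficient AB] inter by simp
  then have "N = A \<inter> B" by (rule card_subset_eq[OF sep(2) N])
  then show ?thesis
    using that C(1) side efficient unfolding full_components_def N_def by simp
qed

lemma efficient_tight_separation:
  assumes P: "regular_bounded_profile P" and P': "regular_bounded_profile P'"
    and AB: "efficient P P' A B"
  shows "tight_separation A B"
proof -
  note regular = regular_bounded_profile_regular[OF P] regular_bounded_profile_regular[OF P']
  obtain C where "C \<in> full_components (A \<inter> B)" "C \<subseteq> B - A"
    using efficient_full_component[OF P regular(2) AB] .
  moreover obtain D where "D \<in> full_components (B \<inter> A)" "D \<subseteq> A - B"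
    using efficient_full_component[OF P' regular(1) efficient_swap[OF AB]] .
  ultimately show ?thesis
    using regular_profile_separation[OF regular(1) efficient_mem[OF AB]]
      regular_profile_finite[OF regular(1) efficient_mem[OF AB]]
    unfolding tight_separation_def by (auto simp: Int_commute)
qed

lemma efficient_separators_tight:
  assumes "regular_bounded_profile P" "regular_bounded_profile P'" "X \<in> efficient_separators P P'"
  shows "tight X"
  using assms efficient_tight_separation tight_separation_separator
  unfolding efficient_separators_def by blast

section \<open>Crossing efficient separators of different order\<close>

lemma robust_efficient_corner:
  assumes P: "regular_profile P" and P': "regular_profile P'" and robust: "robust V E P'"
    and AB: "efficient P P' A B" and CD: "separation V E (C, D)" "finite (C \<inter> D)"
  shows "card (A \<inter> B) \<le> card ((B \<union> C) \<inter> (A \<inter> D)) \<or> card (A \<inter> B) \<le> card ((B \<union> D) \<inter> (A \<inter> C))"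
proof (rule ccontr)
  assume "\<not> ?thesis"
  then have small: "card ((B \<union> C) \<inter> (A \<inter> D)) < card (B \<inter> A)"
      "card ((B \<union> D) \<inter> (A \<inter> C)) < card (B \<inter> A)"
    by (simp_all add: Int_commute)
  have not_mem: "(B \<union> F, A \<inter> G) \<notin> P'" if "card ((B \<union> F) \<inter> (A \<inter> G)) < card (B \<inter> A)" for F G
  proof
    assume "(B \<union> F, A \<inter> G) \<in> P'"
    then have "efficient P' P (B \<union> F) (A \<inter> G)"
      by (rule efficient_greater[OF P' P efficient_swap[OF AB]]) (use that in auto)
    then show False using efficient_card_eq[OF efficient_swap[OF AB]] that by simp
  qed
  have finite: "finite (B \<inter> A)" by (rule regular_profile_finite[OF P' efficient_swap_mem[OF AB]])
  have "finite ((B \<union> C) \<inter> (A \<inter> D))" "finite ((B \<union> D) \<inter> (A \<inter> C))"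
    by (rule finite_subset[OF _ finite_UnI[OF finite CD(2)]], blast)+
  then have "sep_order (sep_join (B, A) (C, D)) < sep_order (B, A)"
    "sep_order (sep_join (B, A) (D, C)) < sep_order (B, A)" "sep_order (C, D) < \<infinity>"
    using small finite CD(2) by simp_all
  then have "sep_join (B, A) (C, D) \<in> P' \<or> sep_join (B, A) (D, C) \<in> P'"
    using robust efficient_swap_mem[OF AB] CD(1) unfolding robust_def by blast
  then show False using not_mem small by simp
qed

lemma different_order_corner:
  assumes P: "regular_profile P" "regular_profile P'" and robust: "robust V E P'"
    and Q: "regular_profile Q" "regular_profile Q'"
    and AB: "efficient P P' A B" "(A, B) \<in> Q" "(A, B) \<in> Q'" and CD: "efficient Q Q' C D"
    and less: "card (A \<inter> B) < card (C \<inter> D)"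
  shows "efficient Q Q' (C \<union> A) (D \<inter> B) \<or> efficient Q' Q (D \<union> A) (C \<inter> B)"
proof (rule ccontr)
  assume none: "\<not> ?thesis"
  note sep_AB = regular_profile_separation[OF Q(1) AB(2)] regular_profile_finite[OF Q(1) AB(2)]
  note sep_CD = regular_profile_separation[OF Q(1) efficient_mem[OF CD]]
    regular_profile_finite[OF Q(1) efficient_mem[OF CD]]
  note sep_DC = regular_profile_separation[OF Q(2) efficient_swap_mem[OF CD]]
    regular_profile_finite[OF Q(2) efficient_swap_mem[OF CD]]
  have large: "card (C \<inter> D) < card ((C \<union> A) \<inter> (D \<inter> B))" "card (D \<inter> C) < card ((D \<union> A) \<inter> (C \<inter> B))"
    using efficient_join[OF Q CD AB(2)] efficient_join[OF Q(2,1) efficient_swap[OF CD] AB(3)] none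
    by (meson not_less)+
  have "card ((D \<union> B) \<inter> (C \<inter> A)) < card (A \<inter> B)"
    using card_opposite_corners[OF sep_CD(1) sep_AB(1) sep_CD(2) sep_AB(2)] large(1) by linarith
  moreover have "card ((C \<union> B) \<inter> (D \<inter> A)) < card (A \<inter> B)"
    using card_opposite_corners[OF sep_DC(1) sep_AB(1) sep_DC(2) sep_AB(2)] large(2) by linarith
  ultimately show False
    using robust_efficient_corner[OF P robust AB(1) sep_CD] by (simp add: ac_simps)
qed

lemma different_order_splinter_oriented:
  assumes P: "regular_bounded_profile P" "regular_bounded_profile P'" and robust: "robust V E P'"
    and Q: "regular_bounded_profile Q" "regular_bounded_profile Q'"
    and AB: "efficient P P' A B" "(A, B) \<in> Q" "(A, B) \<in> Q'" and CD: "efficient Q Q' C D"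
    and less: "card (A \<inter> B) < card (C \<inter> D)"
  shows "\<exists>Z\<in>efficient_separators Q Q'. Z \<subseteq> (A \<inter> B) \<union> (C \<inter> D) \<and> \<not> cross Z (A \<inter> B)"
proof -
  have tight: "tight (A \<inter> B)"
    using tight_separation_separator[OF efficient_tight_separation[OF P AB(1)]] .
  have "efficient Q Q' (C \<union> A) (D \<inter> B) \<or> efficient Q' Q (D \<union> A) (C \<inter> B)"
    using different_order_corner[OF _ _ robust _ _ AB CD less] P Q regular_bounded_profile_regular
    by blast
  then show ?thesis
  proof
    assume corner: "efficient Q Q' (C \<union> A) (D \<inter> B)"
    have "\<not> cross ((C \<union> A) \<inter> (D \<inter> B)) (A \<inter> B)"
      using tight_separation_side_not_cross[OF efficient_tight_separation[OF Q corner] tight]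
        cross_sym by blast
    then show ?thesis
      using efficient_separatorsI[OF corner refl] by (intro bexI conjI) auto
  next
    assume corner: "efficient Q' Q (D \<union> A) (C \<inter> B)"
    have "\<not> cross ((D \<union> A) \<inter> (C \<inter> B)) (A \<inter> B)"
      using tight_separation_side_not_cross[OF efficient_tight_separation[OF Q(2,1) corner] tight]
        cross_sym by blast
    then show ?thesis
      using efficient_separatorsI[OF corner refl] efficient_separators_commute[of Q Q']
      by (intro bexI conjI) auto
  qed
qed

lemma different_order_splinter:
  assumes P: "regular_bounded_profile P" "robust V E P" "regular_bounded_profile P'" "robust V E P'"
    and Q: "regular_bounded_profile Q" "regular_bounded_profile Q'"
    and X: "X \<in> efficient_separators P P'" and Y: "Y \<in> efficient_separators Q Q'"
    and less: "card X < card Y"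
  shows "\<exists>Z\<in>efficient_separators Q Q'. Z \<subseteq> X \<union> Y \<and> \<not> cross Z X"
proof -
  obtain A B where AB: "X = A \<inter> B" "efficient P P' A B"
    using X unfolding efficient_separators_def by blast
  obtain C D where CD: "Y = C \<inter> D" "efficient Q Q' C D"
    using Y unfolding efficient_separators_def by blast
  note regular = regular_bounded_profile_regular
  have "(A, B) \<in> Q \<or> (B, A) \<in> Q" "(A, B) \<in> Q' \<or> (B, A) \<in> Q'"
    using efficient_orients[OF regular[OF Q(1)] regular[OF P(1)] CD(2) AB(2)]
      efficient_orients[OF regular[OF Q(2)] regular[OF P(1)] efficient_swap[OF CD(2)] AB(2)]
      less AB(1) CD(1) by (simp_all add: Int_commute)
  moreover have "\<not> ((A, B) \<in> Q \<and> (B, A) \<in> Q')" "\<not> ((B, A) \<in> Q \<and> (A, B) \<in> Q')"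
    using efficient_card_le[OF CD(2), of A B] efficient_card_le[OF CD(2), of B A] less AB(1) CD(1)
    by (auto simp: Int_commute)
  ultimately consider (towards_B) "(A, B) \<in> Q" "(A, B) \<in> Q'"
    | (towards_A) "(B, A) \<in> Q" "(B, A) \<in> Q'" by blast
  then show ?thesis
  proof cases
    case towards_B
    show ?thesis
      using different_order_splinter_oriented[OF P(1,3,4) Q AB(2) towards_B CD(2)] less AB(1) CD(1) by simp
  next
    case towards_A
    show ?thesis
      using different_order_splinter_oriented[OF P(3,1,2) Q efficient_swap[OF AB(2)] towards_A CD(2)]
        less AB(1) CD(1) by (simp add: Int_commute)
  qed
qed

section \<open>Crossing efficient separators of equal order\<close>

lemma opposite_corners_efficient:
  assumes R: "regular_profile R" "regular_profile R'"
    and S: "regular_profile S" "regular_profile S'"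
    and AB: "efficient R R' A B" and BA_DC: "efficient S S' B A \<or> efficient S S' D C"
    and mem: "(C, D) \<in> R" "(B, A) \<in> S" "(D, C) \<in> S"
    and card: "card (A \<inter> B) = k" "card (C \<inter> D) = k"
  shows "efficient R R' (A \<union> C) (B \<inter> D)" and "efficient S S' (B \<union> D) (A \<inter> C)"
    and "card ((A \<union> C) \<inter> (B \<inter> D)) = k" and "card ((B \<union> D) \<inter> (A \<inter> C)) = k"
proof -
  let ?k = "card ((A \<union> C) \<inter> (B \<inter> D))" and ?k' = "card ((B \<union> D) \<inter> (A \<inter> C))"
  have card': "card (B \<inter> A) = k" "card (D \<inter> C) = k" using card by (simp_all add: Int_commute)
  have corner: "efficient R R' (A \<union> C) (B \<inter> D)" if "?k \<le> k"
    using efficient_join[OF R AB mem(1)] that card by simp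
  have corner': "efficient S S' (B \<union> D) (A \<inter> C)" if "?k' \<le> k"
    using BA_DC
  proof
    assume "efficient S S' B A"
    from efficient_join[OF S this mem(3)] that card' show ?thesis by simp
  next
    assume "efficient S S' D C"
    from efficient_join[OF S this mem(2)] that card' show ?thesis by (simp add: ac_simps)
  qed
  have minimal: "k \<le> ?k" "k \<le> ?k'"
    using corner corner' efficient_card_eq[OF AB] efficient_card_eq[of S S'] BA_DC card card'
    by (metis nle_le)+
  have "?k + ?k' = k + k"
    using card_opposite_corners[of V E A B C D] card regular_profile_separation[OF R(1)]
      regular_profile_finite[OF R(1)] efficient_mem[OF AB] mem(1) by simp
  then show "?k = k" "?k' = k" using minimal by linarith+
  then show "efficient R R' (A \<union> C) (B \<inter> D)" "efficient S S' (B \<union> D) (A \<inter> C)"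
    using corner corner' by simp_all
qed

lemma opposite_corners_splinter:
  assumes \<T>: "\<And>S. S \<in> \<T> \<Longrightarrow> tight S"
    and R: "regular_bounded_profile R" "regular_bounded_profile R'"
    and S: "regular_bounded_profile S" "regular_bounded_profile S'"
    and AB: "efficient R R' A B" and BA_DC: "efficient S S' B A \<or> efficient S S' D C"
    and mem: "(C, D) \<in> R" "(B, A) \<in> S" "(D, C) \<in> S"
    and XY: "X = A \<inter> B" "Y = C \<inter> D" "X \<in> \<T>" "Y \<in> \<T>" "cross X Y" "card X = card Y"
    and le: "cross_number \<T> Y \<le> cross_number \<T> X"
  shows "\<exists>Z \<subseteq> X \<union> Y. Z \<in> efficient_separators R R' \<and> cross_number \<T> Z < cross_number \<T> X \<or>
    Z \<in> efficient_separators S S' \<and>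
      cross_number \<T> Z < cross_number \<T> X \<and> cross_number \<T> Z < cross_number \<T> Y"
proof -
  note regular = regular_bounded_profile_regular
  have card: "card (A \<inter> B) = card Y" "card (C \<inter> D) = card Y" using XY by simp_all
  note corners = opposite_corners_efficient[OF regular[OF R(1)] regular[OF R(2)] regular[OF S(1)]
      regular[OF S(2)] AB BA_DC mem card]
  have sep: "separation V E (A, B)" "separation V E (C, D)"
    using regular_profile_separation[OF regular[OF R(1)]] efficient_mem[OF AB] mem(1) by blast+
  let ?Z = "(A \<union> C) \<inter> (B \<inter> D)" and ?Z' = "(B \<union> D) \<inter> (A \<inter> C)"
  have "cross_number \<T> ?Z + cross_number \<T> ?Z' < cross_number \<T> X + cross_number \<T> Y"
    using cross_number_opposite_corners[OF \<T> sep _ _ _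
        efficient_tight_separation[OF R corners(1)] efficient_tight_separation[OF S corners(2)]
        card corners(3,4)] XY by simp
  then have "cross_number \<T> ?Z < cross_number \<T> X \<or>
      cross_number \<T> ?Z' < cross_number \<T> X \<and> cross_number \<T> ?Z' < cross_number \<T> Y"
    using le by linarith
  moreover have "?Z \<subseteq> X \<union> Y" "?Z' \<subseteq> X \<union> Y" unfolding XY(1,2) by blast+
  ultimately show ?thesis
    using efficient_separatorsI[OF corners(1) refl] efficient_separatorsI[OF corners(2) refl]
    by blast
qed

text \<open>If \<open>P\<close> and \<open>P'\<close> lie in opposite corners, then one of these corners crosses less than \<open>X\<close>,
  which crosses at least as much as \<open>Y\<close>. Otherwise \<open>Q'\<close> lies in the corner opposite to that of
  \<open>P\<close> or \<open>P'\<close>.\<close>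

lemma equal_order_splinter_oriented:
  assumes \<T>: "\<And>S. S \<in> \<T> \<Longrightarrow> tight S"
    and P: "regular_bounded_profile P" "regular_bounded_profile P'"
    and Q: "regular_bounded_profile Q" "regular_bounded_profile Q'"
    and AB: "efficient P P' A B" and CD: "efficient Q Q' C D" "(C, D) \<in> P"
    and XY: "X = A \<inter> B" "Y = C \<inter> D" "X \<in> \<T>" "Y \<in> \<T>" "cross X Y" "card X = card Y"
    and le: "cross_number \<T> Y \<le> cross_number \<T> X"
  shows "\<exists>Z \<subseteq> X \<union> Y. Z \<in> efficient_separators P P' \<and> cross_number \<T> Z < cross_number \<T> X \<or>
    Z \<in> efficient_separators Q Q' \<and> cross_number \<T> Z < cross_number \<T> Y"
proof -
  note AB' = efficient_swap[OF AB] and CD' = efficient_swap[OF CD(1)]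
  note mem = efficient_mem[OF AB'] efficient_mem[OF CD']
  note regular = regular_bounded_profile_regular
  have "(C, D) \<in> P' \<or> (D, C) \<in> P'" "(A, B) \<in> Q' \<or> (B, A) \<in> Q'"
    using efficient_orients[OF regular[OF P(2)] regular[OF Q(1)] AB' CD(1)]
      efficient_orients[OF regular[OF Q(2)] regular[OF P(1)] CD' AB] XY(1,2,6)
    by (simp_all add: Int_commute)
  then consider (P_opposite_P') "(D, C) \<in> P'" | (P_opposite_Q') "(B, A) \<in> Q'"
    | (P'_opposite_Q') "(C, D) \<in> P'" "(A, B) \<in> Q'" by blast
  then show ?thesis
  proof cases
    case P_opposite_P'
    from opposite_corners_splinter[OF \<T> P P(2,1) AB disjI1[OF AB'] CD(2) mem(1) P_opposite_P' XY le]
    show ?thesis unfolding efficient_separators_commute[of P' P] by blast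
  next
    case P_opposite_Q'
    from opposite_corners_splinter[OF \<T> P Q(2,1) AB disjI2[OF CD'] CD(2) P_opposite_Q' mem(2) XY le]
    show ?thesis unfolding efficient_separators_commute[of Q' Q] by blast
  next
    case P'_opposite_Q'
    have "X = B \<inter> A" using XY(1) by blast
    from opposite_corners_splinter
      [OF \<T> P(2,1) Q(2,1) AB' disjI2[OF CD'] P'_opposite_Q' mem(2) this XY(2-6) le]
    show ?thesis
      unfolding efficient_separators_commute[of P' P] efficient_separators_commute[of Q' Q] by blast
  qed
qed

lemma equal_order_splinter_if_le:
  assumes \<T>: "\<And>S. S \<in> \<T> \<Longrightarrow> tight S"
    and P: "regular_bounded_profile P" "regular_bounded_profile P'"
    and Q: "regular_bounded_profile Q" "regular_bounded_profile Q'"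
    and X: "X \<in> efficient_separators P P'" and Y: "Y \<in> efficient_separators Q Q'"
    and XY: "X \<in> \<T>" "Y \<in> \<T>" "cross X Y" "card X = card Y"
    and le: "cross_number \<T> Y \<le> cross_number \<T> X"
  shows "\<exists>Z \<subseteq> X \<union> Y. Z \<in> efficient_separators P P' \<and> cross_number \<T> Z < cross_number \<T> X \<or>
    Z \<in> efficient_separators Q Q' \<and> cross_number \<T> Z < cross_number \<T> Y"
proof -
  obtain A B where AB: "X = A \<inter> B" "efficient P P' A B"
    using X unfolding efficient_separators_def by blast
  obtain C D where CD: "Y = C \<inter> D" "efficient Q Q' C D"
    using Y unfolding efficient_separators_def by blast
  note regular = regular_bounded_profile_regular
  have "(C, D) \<in> P \<or> (D, C) \<in> P"
    using efficient_orients[OF regular[OF P(1)] regular[OF Q(1)] AB(2) CD(2)] XY(4) AB(1) CD(1)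
    by simp
  then show ?thesis
  proof
    assume "(C, D) \<in> P"
    from equal_order_splinter_oriented[OF \<T> P Q AB(2) CD(2) this AB(1) CD(1) XY le]
    show ?thesis .
  next
    assume "(D, C) \<in> P"
    moreover have "Y = D \<inter> C" using CD(1) by blast
    ultimately show ?thesis
      using equal_order_splinter_oriented
        [OF \<T> P Q(2,1) AB(2) efficient_swap[OF CD(2)] _ AB(1) _ XY le]
        efficient_separators_commute[of Q' Q] by simp
  qed
qed

lemma equal_order_splinter:
  assumes \<T>: "\<And>S. S \<in> \<T> \<Longrightarrow> tight S"
    and P: "regular_bounded_profile P" "regular_bounded_profile P'"
    and Q: "regular_bounded_profile Q" "regular_bounded_profile Q'"
    and X: "X \<in> efficient_separators P P'" and Y: "Y \<in> efficient_separators Q Q'"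
    and XY: "X \<in> \<T>" "Y \<in> \<T>" "cross X Y" "card X = card Y"
  shows "\<exists>Z \<subseteq> X \<union> Y. Z \<in> efficient_separators P P' \<and> cross_number \<T> Z < cross_number \<T> X \<or>
    Z \<in> efficient_separators Q Q' \<and> cross_number \<T> Z < cross_number \<T> Y"
proof (cases "cross_number \<T> Y \<le> cross_number \<T> X")
  case True
  from equal_order_splinter_if_le[OF \<T> P Q X Y XY this] show ?thesis .
next
  case False
  then have "cross_number \<T> X \<le> cross_number \<T> Y" by simp
  from equal_order_splinter_if_le[OF \<T> Q P Y X XY(2,1) cross_sym[OF XY(3)] XY(4)[symmetric] this]
  show ?thesis by (auto simp: Un_commute)
qed

section \<open>A non-crossing system of efficient separators\<close>

definition efficient_separator_family :: "'a osep set set \<Rightarrow> 'a set set set" where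
  "efficient_separator_family \<P> =
    {efficient_separators P P' | P P'. P \<in> \<P> \<and> P' \<in> \<P> \<and> efficient_separators P P' \<noteq> {}}"

lemma efficient_separator_family_tight:
  assumes "\<And>P. P \<in> \<P> \<Longrightarrow> regular_bounded_profile P" "X \<in> \<Union>(efficient_separator_family \<P>)"
  shows "tight X"
  using assms efficient_separators_tight unfolding efficient_separator_family_def by blast

lemma efficient_separator_family_corner:
  assumes regular: "\<And>P. P \<in> \<P> \<Longrightarrow> regular_bounded_profile P"
    and mem: "\<A> \<in> efficient_separator_family \<P>" "\<B> \<in> efficient_separator_family \<P>"
    and XY: "X \<in> \<A>" "Y \<in> \<B>" "cross X Y" and Z: "Z \<in> \<A> \<union> \<B>" "Z \<subseteq> X \<union> Y"
  shows "corner cross (\<Union>(efficient_separator_family \<P>)) X Y Z"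
proof -
  have tight: "tight S" if "S \<in> \<Union>(efficient_separator_family \<P>)" for S
    using efficient_separator_family_tight[OF regular that] .
  then have "tight X" "tight Y" "tight Z" using mem XY Z(1) by blast+
  then show ?thesis
    using not_cross_subset_Un[of X Y _ Z] tight XY(3) Z(2) unfolding corner_def by blast
qed

lemma efficient_separator_family_splinter_less:
  assumes profiles: "\<And>P. P \<in> \<P> \<Longrightarrow> regular_bounded_profile P \<and> robust V E P"
    and mem: "\<A> \<in> efficient_separator_family \<P>" "\<B> \<in> efficient_separator_family \<P>"
    and XY: "X \<in> \<A>" "Y \<in> \<B>" "cross X Y" and less: "card X < card Y"
  shows "\<exists>Z\<in>\<B>. \<not> cross Z X \<and> corner cross (\<Union>(efficient_separator_family \<P>)) X Y Z"
proof -
  have profile: "regular_bounded_profile P" "robust V E P" if "P \<in> \<P>" for P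
    using profiles[OF that] by simp_all
  obtain P P' Q Q' where P: "P \<in> \<P>" "P' \<in> \<P>" "\<A> = efficient_separators P P'"
    and Q: "Q \<in> \<P>" "Q' \<in> \<P>" "\<B> = efficient_separators Q Q'"
    using mem unfolding efficient_separator_family_def by blast
  have "\<exists>Z\<in>\<B>. Z \<subseteq> X \<union> Y \<and> \<not> cross Z X"
    using different_order_splinter[OF profile[OF P(1)] profile[OF P(2)] profile(1)[OF Q(1)]
        profile(1)[OF Q(2)]] XY(1,2) less unfolding P(3) Q(3) by blast
  then show ?thesis
    using efficient_separator_family_corner[OF profile(1) mem XY] by blast
qed

lemma efficient_separator_family_splinter_equal:
  assumes profiles: "\<And>P. P \<in> \<P> \<Longrightarrow> regular_bounded_profile P"
    and mem: "\<A> \<in> efficient_separator_family \<P>" "\<B> \<in> efficient_separator_family \<P>"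
    and XY: "X \<in> \<A>" "Y \<in> \<B>" "cross X Y" and eq: "card X = card Y"
    and \<T>: "\<T> = \<Union>(efficient_separator_family \<P>)"
  shows "\<exists>Z. corner cross \<T> X Y Z \<and>
    (Z \<in> \<A> \<and> cross_number \<T> Z < cross_number \<T> X \<or> Z \<in> \<B> \<and> cross_number \<T> Z < cross_number \<T> Y)"
proof -
  obtain P P' Q Q' where P: "P \<in> \<P>" "P' \<in> \<P>" "\<A> = efficient_separators P P'"
    and Q: "Q \<in> \<P>" "Q' \<in> \<P>" "\<B> = efficient_separators Q Q'"
    using mem unfolding efficient_separator_family_def by blast
  have tight: "tight S" if "S \<in> \<T>" for S
    using efficient_separator_family_tight[OF profiles] that \<T> by blast
  have "X \<in> \<T>" "Y \<in> \<T>" using mem XY \<T> by blast+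
  then have "\<exists>Z\<subseteq>X \<union> Y. Z \<in> \<A> \<and> cross_number \<T> Z < cross_number \<T> X \<or>
      Z \<in> \<B> \<and> cross_number \<T> Z < cross_number \<T> Y"
    using equal_order_splinter[OF tight profiles[OF P(1)] profiles[OF P(2)] profiles[OF Q(1)]
        profiles[OF Q(2)]] XY eq unfolding P(3) Q(3) by blast
  then show ?thesis
    using efficient_separator_family_corner[OF profiles mem XY] unfolding \<T> by blast
qed

lemma efficient_separators_thinly_splinter:
  assumes profiles: "\<And>P. P \<in> \<P> \<Longrightarrow> regular_bounded_profile P \<and> robust V E P"
  shows "thinly_splintering (efficient_separator_family \<P>) card cross"
proof
  let ?F = "efficient_separator_family \<P>"
  have regular: "regular_bounded_profile P" if "P \<in> \<P>" for P using profiles[OF that] by simp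
  show "cross Y X" if "cross X Y" for X Y using cross_sym[OF that] .
  show "A \<noteq> {}" if "A \<in> ?F" for A
    using that unfolding efficient_separator_family_def by blast
  show "card X = card Y" if "A \<in> ?F" "X \<in> A" "Y \<in> A" for A X Y
    using that efficient_separators_card_eq unfolding efficient_separator_family_def by blast
  show "finite {Y \<in> \<Union>?F. card Y \<le> card X \<and> cross X Y}" if "X \<in> \<Union>?F" for X
  proof (rule finite_subset)
    show "finite {Y. tight Y \<and> card Y \<le> card X \<and> cross X Y}"
      by (rule finite_cross[OF efficient_separator_family_tight[OF regular that]])
    show "{Y \<in> \<Union>?F. card Y \<le> card X \<and> cross X Y} \<subseteq> {Y. tight Y \<and> card Y \<le> card X \<and> cross X Y}"
      using efficient_separator_family_tight[OF regular] by blast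
  qed
  fix \<A> \<B> X Y assume mem: "\<A> \<in> ?F" "\<B> \<in> ?F" "X \<in> \<A>" "Y \<in> \<B>"
  show "\<exists>Z\<in>\<B>. \<not> cross Z X \<and> corner cross (\<Union>?F) X Y Z" if "card X < card Y" "cross X Y"
    by (rule efficient_separator_family_splinter_less[OF profiles mem that(2,1)])
  show "\<exists>Z. corner cross (\<Union>?F) X Y Z \<and> (Z \<in> \<A> \<and> cross_number (\<Union>?F) Z < cross_number (\<Union>?F) X \<or>
      Z \<in> \<B> \<and> cross_number (\<Union>?F) Z < cross_number (\<Union>?F) Y)"
    if "card X = card Y" "cross X Y"
    by (rule efficient_separator_family_splinter_equal[OF regular mem that(2,1) refl])
qed

lemma noncrossing_efficient_separators:
  assumes profiles: "\<And>P. P \<in> \<P> \<Longrightarrow> regular_bounded_profile P \<and> robust V E P"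
  obtains N where "\<And>X. X \<in> N \<Longrightarrow> tight X" "\<And>X Y. X \<in> N \<Longrightarrow> Y \<in> N \<Longrightarrow> \<not> cross X Y"
    "\<And>P P'. P \<in> \<P> \<Longrightarrow> P' \<in> \<P> \<Longrightarrow> efficient_separators P P' \<noteq> {} \<Longrightarrow>
      efficient_separators P P' \<inter> N \<noteq> {}"
proof -
  interpret thinly_splintering "efficient_separator_family \<P>" card cross
    using efficient_separators_thinly_splinter[OF profiles] .
  obtain N where N: "N \<subseteq> \<Union>(efficient_separator_family \<P>)" "\<forall>X\<in>N. \<forall>Y\<in>N. \<not> cross X Y"
    and meets: "\<forall>A\<in>efficient_separator_family \<P>. A \<inter> N \<noteq> {}"
    using exists_noncrossing_transversal by blast
  show thesis
  proof
    show "tight X" if "X \<in> N" for X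
      using that N(1) efficient_separator_family_tight profiles by blast
    show "\<not> cross X Y" if "X \<in> N" "Y \<in> N" for X Y using that N(2) by blast
    show "efficient_separators P P' \<inter> N \<noteq> {}"
      if "P \<in> \<P>" "P' \<in> \<P>" "efficient_separators P P' \<noteq> {}" for P P'
      using that meets unfolding efficient_separator_family_def by blast
  qed
qed

section \<open>From separators to nested separations\<close>

definition component_cut :: "'a set \<Rightarrow> 'a set \<Rightarrow> 'a usep" where
  "component_cut X C = {V - C, C \<union> X}"

lemma component_cut_unoriented_separation:
  assumes "C \<in> full_components X"
  shows "component_cut X C \<in> unoriented_separations V E"
proof -
  have "C \<subseteq> V" "neighbourhood C \<subseteq> X"
    using assms components_subset unfolding full_components_def by blast+
  then have "separation V E (V - C, C \<union> X)"
    using separation_towards full_component_separator_subset[OF assms] by blast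
  then show ?thesis unfolding component_cut_def unoriented_separations_def by blast
qed

lemma nested_component_cut_if_avoids:
  assumes C: "C \<in> full_components X" and D: "D \<in> full_components Y" and avoids: "C \<inter> Y = {}"
  shows "nested (component_cut X C) (component_cut Y D)"
proof -
  have components: "C \<in> components X" "D \<in> components Y"
    using C D full_components_subset by blast+
  note V = full_component_separator_subset[OF C] full_component_separator_subset[OF D]
  obtain c where c: "c \<in> C" using components_nonempty[OF components(1)] by blast
  have "component X c = C" by (rule component_eq_if_mem[OF components(1) c])
  then have "C \<subseteq> component Y c" using component_subset_component avoids by blast
  moreover have "x \<in> component Y c" if "x \<in> X - Y" for x
    using full_component_attaches[OF C avoids that c] .
  ultimately have below: "C \<union> X \<subseteq> component Y c \<union> Y" by blast
  show ?thesis
  proof (cases "c \<in> D")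
    case True
    then have "component Y c = D" by (rule component_eq_if_mem[OF components(2)])
    then have "sep_le (C \<union> X, V - C) (D \<union> Y, V - D)"
      using below avoids by auto
    from nestedI[OF this] show ?thesis by (simp add: component_cut_def insert_commute)
  next
    case False
    then have "component Y c \<inter> D = {}"
      using component_eq[of _ Y c] component_eq_if_mem[OF components(2)] component_refl[of c Y]
      by blast
    then have "C \<union> X \<subseteq> V - D" "D \<union> Y \<subseteq> V - C"
      using below avoids components_subset[OF components(1)] components_subset[OF components(2)] V
      by blast+
    then have "sep_le (C \<union> X, V - C) (V - D, D \<union> Y)" by simp
    from nestedI[OF this] show ?thesis by (simp add: component_cut_def insert_commute)
  qed
qed

lemma other_full_component_subset:
  assumes not_cross: "\<not> cross X Y" and C: "C \<in> full_components X" "C \<inter> Y \<noteq> {}"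
    and D: "D \<in> full_components Y" "D \<inter> X \<noteq> {}" and D': "D' \<in> full_components Y" "D' \<noteq> D"
  shows "D' \<subseteq> C"
proof -
  have components: "C \<in> components X" "D \<in> components Y" "D' \<in> components Y"
    using C(1) D(1) D'(1) full_components_subset by blast+
  have "\<not> separates Y X" using not_cross by (simp add: cross_def)
  then have avoids: "D' \<inter> X = {}"
    using component_avoids_if_not_separates[OF _ components(2,3)] D(2) D'(2) by blast
  obtain y where y: "y \<in> C" "y \<in> Y - X" using C(2) components_subset[OF components(1)] by blast
  have "z \<in> component X y" if "z \<in> D'" for z
    using full_component_attaches[OF D'(1) avoids y(2) that] by (rule component_sym)
  then show ?thesis using component_eq_if_mem[OF components(1) y(1)] by blast
qed

lemma tight_Union_full_components: "tight X \<Longrightarrow> \<Union>(full_components X) \<noteq> {}"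
  using components_nonempty full_components_subset unfolding tight_def by blast

text \<open>The cuts at full components \<open>C\<close> of \<open>G - X\<close> and \<open>D\<close> of \<open>G - Y\<close> that contain the rest of
  the other separator need not be nested, as there may be components attached to \<open>X \<inter> Y\<close> only.
  So one full component is left out for every separator.\<close>

lemma nested_component_cuts:
  assumes tight: "\<And>X. X \<in> N \<Longrightarrow> tight X"
    and not_cross: "\<And>X Y. X \<in> N \<Longrightarrow> Y \<in> N \<Longrightarrow> \<not> cross X Y"
  obtains M where "M \<subseteq> unoriented_separations V E" "nested_set M"
    "\<And>X C D. X \<in> N \<Longrightarrow> C \<in> full_components X \<Longrightarrow> D \<in> full_components X \<Longrightarrow> C \<noteq> D \<Longrightarrow>
      component_cut X C \<in> M \<or> component_cut X D \<in> M"
proof -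
  from coherent_choice
    [of N full_components, OF tight_Union_full_components[OF tight] full_components_disjnt]
  obtain f where f: "\<And>X. X \<in> N \<Longrightarrow> f X \<in> full_components X"
    and coherent: "\<And>X Y C D. X \<in> N \<Longrightarrow> Y \<in> N \<Longrightarrow> C \<in> full_components X \<Longrightarrow> D \<in> full_components Y \<Longrightarrow>
      f Y \<subseteq> C \<Longrightarrow> f X \<subseteq> D \<Longrightarrow> C = f X"
    by blast
  define M where "M = {component_cut X C | X C. X \<in> N \<and> C \<in> full_components X \<and> C \<noteq> f X}"
  have "nested (component_cut X C) (component_cut Y D)"
    if X: "X \<in> N" "C \<in> full_components X" "C \<noteq> f X"
      and Y: "Y \<in> N" "D \<in> full_components Y" "D \<noteq> f Y" for X C Y D
  proof -
    have "C \<inter> Y = {} \<or> D \<inter> X = {}"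
    proof (rule ccontr)
      assume "\<not> ?thesis"
      then have "f Y \<subseteq> C" "f X \<subseteq> D"
        using other_full_component_subset[OF not_cross[OF X(1) Y(1)] X(2) _ Y(2) _ f[OF Y(1)]]
          other_full_component_subset[OF not_cross[OF Y(1) X(1)] Y(2) _ X(2) _ f[OF X(1)]] X(3) Y(3)
        by blast+
      then show False using coherent[OF X(1) Y(1) X(2) Y(2)] X(3) by blast
    qed
    then show ?thesis
      using nested_component_cut_if_avoids[OF X(2) Y(2)]
        nested_component_cut_if_avoids[OF Y(2) X(2)] nested_sym by blast
  qed
  then have nested: "nested_set M" unfolding nested_set_def M_def by blast
  have "M \<subseteq> unoriented_separations V E"
    using component_cut_unoriented_separation unfolding M_def by blast
  moreover note nested
  moreover have "component_cut X C \<in> M \<or> component_cut X D \<in> M"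
    if "X \<in> N" "C \<in> full_components X" "D \<in> full_components X" "C \<noteq> D" for X C D
    using that unfolding M_def by blast
  ultimately show thesis by (rule that)
qed

lemma efficient_separator_component_cuts:
  assumes P: "regular_bounded_profile P" and P': "regular_bounded_profile P'"
    and X: "X \<in> efficient_separators P P'"
  obtains C D where "C \<in> full_components X" "D \<in> full_components X" "C \<noteq> D"
    "efficiently_distinguishes V E (component_cut X C) P P'"
    "efficiently_distinguishes V E (component_cut X D) P P'"
proof -
  obtain A B where AB: "X = A \<inter> B" "efficient P P' A B"
    using X unfolding efficient_separators_def by blast
  note regular = regular_bounded_profile_regular[OF P] regular_bounded_profile_regular[OF P']
  obtain C where C: "C \<in> full_components X" "C \<subseteq> B - A" "efficient P P' (V - C) (C \<union> X)"
    using efficient_full_component[OF P regular(2) AB(2)] AB(1) by metis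
  obtain D where D: "D \<in> full_components X" "D \<subseteq> A - B" "efficient P' P (V - D) (D \<union> X)"
    using efficient_full_component[OF P' regular(1) efficient_swap[OF AB(2)]] AB(1)
    by (metis Int_commute)
  have "C \<noteq> {}" using C(1) components_nonempty full_components_subset by blast
  then have "C \<noteq> D" using C(2) D(2) by blast
  moreover have "efficiently_distinguishes V E (component_cut X C) P P'"
    using efficient_efficiently_distinguishes[OF regular(1) C(3)] by (simp add: component_cut_def)
  moreover have "efficiently_distinguishes V E (component_cut X D) P P'"
    using efficient_efficiently_distinguishes[OF regular(1) efficient_swap[OF D(3)]]
    by (simp add: component_cut_def insert_commute)
  ultimately show thesis using that C(1) D(1) by blast
qed

end

theorem theorem4p2:
  fixes V :: "'a set" and E :: "'a set set" and \<P> :: "'a osep set set"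
  assumes "connected_graph V E"
    and "\<And>P. P \<in> \<P> \<Longrightarrow> bounded_profile V E P \<and> robust V E P \<and> regular V P"
  shows "\<exists>N \<subseteq> unoriented_separations V E. nested_set N \<and>
    (\<forall>P\<in>\<P>. \<forall>P'\<in>\<P>. distinguishable V E P P' \<longrightarrow>
       (\<exists>r\<in>N. efficiently_distinguishes V E r P P'))"
proof -
  interpret graph_separations V E
    by unfold_locales (use assms(1) in \<open>simp add: connected_graph_def\<close>)
  have profiles: "regular_bounded_profile P \<and> robust V E P" if "P \<in> \<P>" for P
    using assms(2)[OF that] by (simp add: regular_bounded_profile_def)
  obtain N where tight: "\<And>X. X \<in> N \<Longrightarrow> tight X"
    and not_cross: "\<And>X Y. X \<in> N \<Longrightarrow> Y \<in> N \<Longrightarrow> \<not> cross X Y"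
    and meets: "\<And>P P'. P \<in> \<P> \<Longrightarrow> P' \<in> \<P> \<Longrightarrow> efficient_separators P P' \<noteq> {} \<Longrightarrow>
      efficient_separators P P' \<inter> N \<noteq> {}"
    using noncrossing_efficient_separators[OF profiles] by blast
  obtain M where M: "M \<subseteq> unoriented_separations V E" "nested_set M"
    and cuts: "\<And>X C D. X \<in> N \<Longrightarrow> C \<in> full_components X \<Longrightarrow> D \<in> full_components X \<Longrightarrow> C \<noteq> D \<Longrightarrow>
      component_cut X C \<in> M \<or> component_cut X D \<in> M"
    using nested_component_cuts[OF tight not_cross] by blast
  have "\<exists>r\<in>M. efficiently_distinguishes V E r P P'"
    if PP': "P \<in> \<P>" "P' \<in> \<P>" "distinguishable V E P P'" for P P'
  proof -
    obtain X where "X \<in> efficient_separators P P'" "X \<in> N"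
      using meets[OF PP'(1,2) distinguishable_efficient_separators[OF PP'(3)]] by blast
    then show ?thesis
      using efficient_separator_component_cuts[of P P' X] profiles PP'(1,2) cuts[of X] by metis
  qed
  then show ?thesis using M by blast
qed

end
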